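(* Let $M$ be a simple rank 3 matroid, and suppose that all edges of its Levi graph $\Gamma_M$ have length 1. If $W$ is an adjoint of $M$, then there is a matroidal linear series $\Sigma\subseteq R(D_M)$ such that $M_\Sigma=W$, where $D_M$ is the Cartwright divisor of $M$.
   Context: Let $M$ be a simple rank 3 matroid on a finite set $E$ and $H$ its set of rank 2 flats. The Levi graph $\Gamma_M$ is the bipartite graph with vertex set $E\sqcup H$ and an edge $[e,F]$ whenever $e\in F$, regarded as a metric graph. The Cartwright divisor is $D_M=\sum_{e\in E}e$. The connected components of $\Gamma_M\smallsetminus\mathrm{supp}(D_M)$ are the open subgraphs $\gamma_F$, $F\in H$, consisting of the vertex $F$ and the interiors of its adjacent edges; the set of these components is identified with $H$. Adjoint: for a simple rank $r$ matroid $M$ with set $H$ of corank 1 flats, an adjoint of $M$ is a rank $r$ matroid $W$ on $H$ such that, for each $k$ and each rank $k$ flat $F$ of $M$, the set $\{H_i\in H:F\subseteq H_i\}$ is a corank $k$ flat of $W$. On a metric graph $\Gamma$: a divisor $D$ is a finite formal $\mathbb Z$-combination of points; effective ($\ge0$) means all coefficients are nonnegative; $\mathrm{supp}(D)$ is the set of points with nonzero coefficient. $\mathrm{PL}(\Gamma)$ is the set of continuous piecewise-linear functions with integer slopes; $\mathrm{div}(\varphi)$ has multiplicity at $p$ the sum of the incoming slopes (minus the sum of the outgoing slopes) of $\varphi$ at $p$; $R(D)=\{\varphi\in\mathrm{PL}(\Gamma):D+\mathrm{div}(\varphi)\ge0\}$. A tropical submodule of $R(D)$ is a subset closed under pointwise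 minimum and addition of real constants (a zero element $\infty$ is tacitly adjoined); it is finitely generated if it consists of all finite combinations $\min_i\{\varphi_i+a_i\}$ of a finite set. $r_{\mathrm{BN}}(\Sigma)$ is the largest integer $r$ such that for every effective $D'$ of degree $r$ there is $\varphi\in\Sigma$ with $D-D'+\mathrm{div}(\varphi)\ge0$. A finite set $\{\varphi_0,\dots,\varphi_s\}$ is tropically dependent if there are reals $a_i$ such that at every point of $\Gamma$ the minimum $\min_i\{\varphi_i+a_i\}$ is achieved at least twice, and independent otherwise; $r_{\mathrm{ind}}(\Sigma)$ is the size of the largest independent subset. A tropical linear series of dimension $r$ is a finitely generated $\Sigma\subseteq R(D)$ with $r_{\mathrm{BN}}(\Sigma)=r$, $r_{\mathrm{ind}}(\Sigma)=r+1$. A valuated matroid is a tropical submodule $\mathcal V\subseteq\overline{\mathbb R}^N$, $\overline{\mathbb R}=\mathbb R\cup\{\infty\}$ (closed under coordinatewise $\min$ and adding scalars), such that whenever $w,w'\in\mathcal V$ and $w_i=w'_i$ there is $w''\in\mathcal V$ with $w''_i=\infty$ and $w''_j\ge\min\{w_j,w'_j\}$ for $j\ne i$, with equality when $w_j\neq w'_j$. Its rank is the rank of the matroid whose covectors (complements of flats) are the sets $\{i:w_i\ne\infty\}$, $w\in\mathcal V$. A tropical linear series of dimension $r$ is a matroidal linear series if it is the image of a homomorphism of tropical modules from a valuated matroid of rank $r+1$. Local matroid: for a tropical linear series $\Sigma\subseteq R(D_M)$, $M_\Sigma$ is the matroid on the set of connected components of $\Gamma_M\smallsetminus\mathrm{supp}(D_M)$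 (identified with $H$) whose flats are the whole ground set and the sets $F_\varphi=\{F\in H:\gamma_F\not\subseteq\varphi_{\min}\}$, $\varphi\in\Sigma$, where $\varphi_{\min}$ is the set of points where $\varphi$ attains its minimum; in this setting this collection is always the lattice of flats of a matroid, of rank $\dim\Sigma+1$. *)

theory Defs
  imports Complex_Main "HOL-Library.FuncSet" "HOL-Library.Extended_Real"
begin

section \<open>Matroids\<close>

record 'a matroid =
  ground :: "'a set"
  indep :: "'a set set"

definition is_matroid :: "'a matroid \<Rightarrow> bool" where
  "is_matroid M \<longleftrightarrow>
     finite (ground M) \<and> indep M \<subseteq> Pow (ground M) \<and> {} \<in> indep M \<and>
     (\<forall>I\<in>indep M. \<forall>J. J \<subseteq> I \<longrightarrow> J \<in> indep M) \<and>
     (\<forall>I\<in>indep M. \<forall>J\<in>indep M. card I < card J \<longrightarrow> (\<exists>x\<in>J - I. insert x I \<in> indep M))"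

definition rk :: "'a matroid \<Rightarrow> 'a set \<Rightarrow> nat" where
  "rk M X = Max (card ` {I \<in> indep M. I \<subseteq> X})"

definition matroid_rank :: "'a matroid \<Rightarrow> nat" where
  "matroid_rank M = rk M (ground M)"

definition flats :: "'a matroid \<Rightarrow> 'a set set" where
  "flats M = {F. F \<subseteq> ground M \<and> (\<forall>x\<in>ground M - F. rk M F < rk M (insert x F))}"

definition rank_flats :: "'a matroid \<Rightarrow> nat \<Rightarrow> 'a set set" where
  "rank_flats M k = {F \<in> flats M. rk M F = k}"

definition corank_flats :: "'a matroid \<Rightarrow> nat \<Rightarrow> 'a set set" where
  "corank_flats M k = {F \<in> flats M. rk M F + k = matroid_rank M}"

text \<open>No loops and no parallel elements (for \<open>x = y\<close> the condition excludes loops).\<close>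

definition is_simple :: "'a matroid \<Rightarrow> bool" where
  "is_simple M \<longleftrightarrow> (\<forall>x\<in>ground M. \<forall>y\<in>ground M. {x, y} \<in> indep M)"

definition is_adjoint :: "'a matroid \<Rightarrow> 'a set matroid \<Rightarrow> bool" where
  "is_adjoint M W \<longleftrightarrow>
     is_matroid W \<and> ground W = corank_flats M 1 \<and> matroid_rank W = matroid_rank M \<and>
     (\<forall>k. \<forall>F\<in>rank_flats M k. {X \<in> corank_flats M 1. F \<subseteq> X} \<in> corank_flats W k)"


section \<open>Metric graphs, divisors and piecewise-linear functions\<close>

text \<open>
  A metric graph is given by a model: an oriented multigraph with edge lengths. The orientation
  only serves to parametrise an edge \<open>e\<close> by the interval from \<open>0\<close> (at \<open>tail e\<close>) to \<open>len e\<close>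
  (at \<open>head e\<close>). Each point of the metric graph has exactly one name: vertices are \<open>Vertex v\<close>,
  and \<open>Interior e t\<close> is the point of the open edge \<open>e\<close> at distance \<open>t\<close> from its tail.
\<close>

record ('v, 'e) mgraph =
  verts :: "'v set"
  edges :: "'e set"
  tail :: "'e \<Rightarrow> 'v"
  head :: "'e \<Rightarrow> 'v"
  len :: "'e \<Rightarrow> real"

datatype ('v, 'e) point = Vertex 'v | Interior 'e real

definition points :: "('v, 'e) mgraph \<Rightarrow> ('v, 'e) point set" where
  "points G = Vertex ` verts G \<union> {Interior e t | e t. e \<in> edges G \<and> 0 < t \<and> t < len G e}"

definition edge_point :: "('v, 'e) mgraph \<Rightarrow> 'e \<Rightarrow> real \<Rightarrow> ('v, 'e) point" where
  "edge_point G e t =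
     (if t = 0 then Vertex (tail G e) else if t = len G e then Vertex (head G e) else Interior e t)"

definition is_divisor :: "('v, 'e) mgraph \<Rightarrow> (('v, 'e) point \<Rightarrow> int) \<Rightarrow> bool" where
  "is_divisor G D \<longleftrightarrow> finite {p. D p \<noteq> 0} \<and> {p. D p \<noteq> 0} \<subseteq> points G"

definition divisor_degree :: "(('v, 'e) point \<Rightarrow> int) \<Rightarrow> int" where
  "divisor_degree D = (\<Sum>p | D p \<noteq> 0. D p)"

definition effective :: "(('v, 'e) point \<Rightarrow> int) \<Rightarrow> bool" where
  "effective D \<longleftrightarrow> (\<forall>p. D p \<ge> 0)"

definition pl_on :: "real \<Rightarrow> (real \<Rightarrow> real) \<Rightarrow> bool" where
  "pl_on L g \<longleftrightarrow> continuous_on {0..L} g \<and>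
     (\<exists>B. finite B \<and>
        (\<forall>a b. 0 \<le> a \<and> a < b \<and> b \<le> L \<and> {a<..<b} \<inter> B = {} \<longrightarrow>
           (\<exists>(s::int) c. \<forall>t\<in>{a<..<b}. g t = of_int s * t + c)))"

text \<open>
  Functions on a metric graph are extensional on its point set, so that equality of elements
  of \<open>PL G\<close> is equality of functions on the metric graph. For a finite graph, continuity is
  continuity along each closed edge, since the values at the endpoints are shared.
\<close>

definition PL :: "('v, 'e) mgraph \<Rightarrow> (('v, 'e) point \<Rightarrow> real) set" where
  "PL G = {\<phi> \<in> extensional (points G). \<forall>e\<in>edges G. pl_on (len G e) (\<lambda>t. \<phi> (edge_point G e t))}"

definition left_slope :: "(real \<Rightarrow> real) \<Rightarrow> real \<Rightarrow> int" where
  "left_slope g t = (THE s. \<exists>\<epsilon>>0. \<forall>h\<in>{0..\<epsilon>}. g (t - h) = g t - of_int s * h)"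

definition right_slope :: "(real \<Rightarrow> real) \<Rightarrow> real \<Rightarrow> int" where
  "right_slope g t = (THE s. \<exists>\<epsilon>>0. \<forall>h\<in>{0..\<epsilon>}. g (t + h) = g t + of_int s * h)"

text \<open>
  The multiplicity of \<open>div\<close> at a point is the sum, over all tangent directions, of the slopes of
  \<open>\<phi>\<close> along the paths towards the point. Along the orientation of an edge the left slope is
  incoming and the right slope is outgoing, so the latter enters with a minus sign.
\<close>

definition divis :: "('v, 'e) mgraph \<Rightarrow> (('v, 'e) point \<Rightarrow> real) \<Rightarrow> ('v, 'e) point \<Rightarrow> int" where
  "divis G \<phi> p =
     (if p \<notin> points G then 0
      else (case p of
          Vertex v \<Rightarrow>
            (\<Sum>e | e \<in> edges G \<and> head G e = v. left_slope (\<lambda>t. \<phi> (edge_point G e t)) (len G e))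
          - (\<Sum>e | e \<in> edges G \<and> tail G e = v. right_slope (\<lambda>t. \<phi> (edge_point G e t)) 0)
        | Interior e t \<Rightarrow>
            left_slope (\<lambda>u. \<phi> (edge_point G e u)) t - right_slope (\<lambda>u. \<phi> (edge_point G e u)) t))"

definition RD ::
  "('v, 'e) mgraph \<Rightarrow> (('v, 'e) point \<Rightarrow> int) \<Rightarrow> (('v, 'e) point \<Rightarrow> real) set" where
  "RD G D = {\<phi> \<in> PL G. effective (\<lambda>p. D p + divis G \<phi> p)}"


section \<open>Tropical linear series\<close>

text \<open>
  Tropical operations on functions with domain \<open>X\<close>; they are used both for real-valued functions
  on a metric graph and for vectors with entries in \<open>\<real> \<union> {\<infinity>}\<close>, which are represented as
  extended reals different from \<open>-\<infinity>\<close>.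
\<close>

definition tmin :: "'x set \<Rightarrow> ('x \<Rightarrow> 'b::linorder) \<Rightarrow> ('x \<Rightarrow> 'b) \<Rightarrow> 'x \<Rightarrow> 'b" where
  "tmin X f g = (\<lambda>x\<in>X. min (f x) (g x))"

definition tscale :: "'x set \<Rightarrow> 'b::plus \<Rightarrow> ('x \<Rightarrow> 'b) \<Rightarrow> 'x \<Rightarrow> 'b" where
  "tscale X a f = (\<lambda>x\<in>X. f x + a)"

definition tropical_submodule ::
  "('v, 'e) mgraph \<Rightarrow> (('v, 'e) point \<Rightarrow> int) \<Rightarrow> (('v, 'e) point \<Rightarrow> real) set \<Rightarrow> bool" where
  "tropical_submodule G D S \<longleftrightarrow> S \<subseteq> RD G D \<and>
     (\<forall>\<phi>\<in>S. \<forall>\<psi>\<in>S. tmin (points G) \<phi> \<psi> \<in> S) \<and>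
     (\<forall>\<phi>\<in>S. \<forall>a. tscale (points G) a \<phi> \<in> S)"

definition finitely_generated ::
  "('v, 'e) mgraph \<Rightarrow> (('v, 'e) point \<Rightarrow> real) set \<Rightarrow> bool" where
  "finitely_generated G S \<longleftrightarrow>
     (\<exists>B. finite B \<and>
        S = {(\<lambda>p\<in>points G. Min ((\<lambda>\<phi>. \<phi> p + a \<phi>) ` T)) | T a. T \<subseteq> B \<and> T \<noteq> {}})"

definition BN_values ::
  "('v, 'e) mgraph \<Rightarrow> (('v, 'e) point \<Rightarrow> int) \<Rightarrow> (('v, 'e) point \<Rightarrow> real) set \<Rightarrow> int set" where
  "BN_values G D S =
     {r. \<forall>D'. is_divisor G D' \<and> effective D' \<and> divisor_degree D' = r \<longrightarrow>
           (\<exists>\<phi>\<in>S. effective (\<lambda>p. D p - D' p + divis G \<phi> p))}"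

definition is_r_BN ::
  "('v, 'e) mgraph \<Rightarrow> (('v, 'e) point \<Rightarrow> int) \<Rightarrow> (('v, 'e) point \<Rightarrow> real) set \<Rightarrow> int \<Rightarrow> bool" where
  "is_r_BN G D S r \<longleftrightarrow> r \<in> BN_values G D S \<and> (\<forall>r'\<in>BN_values G D S. r' \<le> r)"

definition tropically_dependent ::
  "('v, 'e) mgraph \<Rightarrow> (('v, 'e) point \<Rightarrow> real) set \<Rightarrow> bool" where
  "tropically_dependent G B \<longleftrightarrow>
     (\<exists>a. \<forall>p\<in>points G. \<exists>\<phi>\<in>B. \<exists>\<psi>\<in>B. \<phi> \<noteq> \<psi> \<and>
        (\<forall>\<chi>\<in>B. \<phi> p + a \<phi> \<le> \<chi> p + a \<chi>) \<and> (\<forall>\<chi>\<in>B. \<psi> p + a \<psi> \<le> \<chi> p + a \<chi>))"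

definition is_r_ind ::
  "('v, 'e) mgraph \<Rightarrow> (('v, 'e) point \<Rightarrow> real) set \<Rightarrow> nat \<Rightarrow> bool" where
  "is_r_ind G S k \<longleftrightarrow>
     (\<exists>B\<subseteq>S. finite B \<and> \<not> tropically_dependent G B \<and> card B = k) \<and>
     (\<forall>B\<subseteq>S. finite B \<and> \<not> tropically_dependent G B \<longrightarrow> card B \<le> k)"

definition tropical_linear_series ::
  "('v, 'e) mgraph \<Rightarrow> (('v, 'e) point \<Rightarrow> int) \<Rightarrow> nat \<Rightarrow> (('v, 'e) point \<Rightarrow> real) set \<Rightarrow> bool" where
  "tropical_linear_series G D r S \<longleftrightarrow>
     tropical_submodule G D S \<and> finitely_generated G S \<and>
     is_r_BN G D S (int r) \<and> is_r_ind G S (r + 1)"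


section \<open>Valuated matroids and matroidal linear series\<close>

text \<open>
  Scalars range over \<open>\<real> \<union> {\<infinity>}\<close>; hence a nonempty \<open>V\<close> contains the zero element, the
  vector with all entries \<open>\<infinity>\<close>.
\<close>

definition valuated_matroid :: "'i set \<Rightarrow> ('i \<Rightarrow> ereal) set \<Rightarrow> bool" where
  "valuated_matroid N V \<longleftrightarrow>
     finite N \<and> V \<noteq> {} \<and> V \<subseteq> (N \<rightarrow>\<^sub>E {x. x \<noteq> -\<infinity>}) \<and>
     (\<forall>w\<in>V. \<forall>w'\<in>V. tmin N w w' \<in> V) \<and>
     (\<forall>w\<in>V. \<forall>a. a \<noteq> -\<infinity> \<longrightarrow> tscale N a w \<in> V) \<and>
     (\<forall>w\<in>V. \<forall>w'\<in>V. \<forall>i\<in>N. w i = w' i \<longrightarrow>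
        (\<exists>w''\<in>V. w'' i = \<infinity> \<and>
           (\<forall>j\<in>N - {i}. w'' j \<ge> min (w j) (w' j) \<and>
              (w j \<noteq> w' j \<longrightarrow> w'' j = min (w j) (w' j)))))"

definition valuated_matroid_has_rank :: "'i set \<Rightarrow> ('i \<Rightarrow> ereal) set \<Rightarrow> nat \<Rightarrow> bool" where
  "valuated_matroid_has_rank N V k \<longleftrightarrow>
     (\<exists>U. is_matroid U \<and> ground U = N \<and> matroid_rank U = k \<and>
        {N - F | F. F \<in> flats U} = {{i \<in> N. w i \<noteq> \<infinity>} | w. w \<in> V})"

text \<open>The functions in \<open>S\<close> viewed as \<open>\<real> \<union> {\<infinity>}\<close>-valued, together with the zero element \<open>\<infinity>\<close>.\<close>

definition adjoin_zero ::
  "('v, 'e) mgraph \<Rightarrow> (('v, 'e) point \<Rightarrow> real) set \<Rightarrow> (('v, 'e) point \<Rightarrow> ereal) set" where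
  "adjoin_zero G S =
     insert (\<lambda>p\<in>points G. \<infinity>) ((\<lambda>\<phi>. \<lambda>p\<in>points G. ereal (\<phi> p)) ` S)"

text \<open>The scalar \<open>a = \<infinity>\<close> is included, so a homomorphism maps the zero element to the zero element.\<close>

definition tropical_hom ::
  "'i set \<Rightarrow> ('i \<Rightarrow> ereal) set \<Rightarrow> 'x set \<Rightarrow> (('i \<Rightarrow> ereal) \<Rightarrow> 'x \<Rightarrow> ereal) \<Rightarrow> bool" where
  "tropical_hom N V X f \<longleftrightarrow>
     (\<forall>w\<in>V. \<forall>w'\<in>V. f (tmin N w w') = tmin X (f w) (f w')) \<and>
     (\<forall>w\<in>V. \<forall>a. a \<noteq> -\<infinity> \<longrightarrow> f (tscale N a w) = tscale X a (f w))"

text \<open>Index sets of valuated matroids are finite, so sets of natural numbers suffice.\<close>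

definition matroidal_linear_series ::
  "('v, 'e) mgraph \<Rightarrow> (('v, 'e) point \<Rightarrow> int) \<Rightarrow> nat \<Rightarrow> (('v, 'e) point \<Rightarrow> real) set \<Rightarrow> bool" where
  "matroidal_linear_series G D r S \<longleftrightarrow>
     tropical_linear_series G D r S \<and>
     (\<exists>(N :: nat set) V f.
        valuated_matroid N V \<and> valuated_matroid_has_rank N V (r + 1) \<and>
        tropical_hom N V (points G) f \<and> f ` V = adjoin_zero G S)"


section \<open>Levi graph, Cartwright divisor and local matroid\<close>

definition levi_graph ::
  "'a matroid \<Rightarrow> ('a \<times> 'a set \<Rightarrow> real) \<Rightarrow> ('a + 'a set, 'a \<times> 'a set) mgraph" where
  "levi_graph M l =
     \<lparr>verts = ground M <+> rank_flats M 2,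
      edges = {(e, F). e \<in> F \<and> F \<in> rank_flats M 2},
      tail = (\<lambda>(e, F). Inl e),
      head = (\<lambda>(e, F). Inr F),
      len = l\<rparr>"

definition cartwright_divisor :: "'a matroid \<Rightarrow> ('a + 'a set, 'a \<times> 'a set) point \<Rightarrow> int" where
  "cartwright_divisor M p = (if p \<in> (\<lambda>e. Vertex (Inl e)) ` ground M then 1 else 0)"

definition min_locus :: "('v, 'e) mgraph \<Rightarrow> (('v, 'e) point \<Rightarrow> real) \<Rightarrow> ('v, 'e) point set" where
  "min_locus G \<phi> = {p \<in> points G. \<forall>q\<in>points G. \<phi> p \<le> \<phi> q}"

text \<open>
  For the Levi graph, the sets \<open>open_star (levi_graph M l) (Inr F)\<close>, \<open>F\<close> a rank 2 flat, are the
  connected components of the complement of the support of the Cartwright divisor.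
\<close>

definition open_star :: "('v, 'e) mgraph \<Rightarrow> 'v \<Rightarrow> ('v, 'e) point set" where
  "open_star G v =
     insert (Vertex v)
       {Interior e t | e t. e \<in> edges G \<and> (tail G e = v \<or> head G e = v) \<and> 0 < t \<and> t < len G e}"

definition is_local_matroid ::
  "'a matroid \<Rightarrow> ('a \<times> 'a set \<Rightarrow> real) \<Rightarrow> (('a + 'a set, 'a \<times> 'a set) point \<Rightarrow> real) set
     \<Rightarrow> 'a set matroid \<Rightarrow> bool" where
  "is_local_matroid M l S W \<longleftrightarrow>
     is_matroid W \<and> ground W = rank_flats M 2 \<and>
     flats W = insert (rank_flats M 2)
       {{F \<in> rank_flats M 2.
           \<not> open_star (levi_graph M l) (Inr F) \<subseteq> min_locus (levi_graph M l) \<phi>} | \<phi>. \<phi> \<in> S}"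

end

theory Submission
  imports Defs
begin

text \<open>
  A vector \<open>w\<close> on the set of lines \<open>H\<close> all of whose superlevel sets are flats of \<open>W\<close> (an element of
  the valuated matroid of \<open>W\<close> with trivial valuation) is mapped to the function \<open>phi w\<close> on the Levi
  graph that on the edge from \<open>e\<close> to \<open>F\<close>, at distance \<open>t\<close> from \<open>e\<close>, has the value
  \<open>min (w F) (min (A + t) (m + 2 - t))\<close>, where \<open>A\<close> is the minimum of \<open>w\<close> over the lines through
  \<open>e\<close> and \<open>m\<close> the minimum of \<open>w\<close> over all lines. Every value of \<open>phi w\<close> is a tropical linear form
  \<open>min (w F + gap F p)\<close> in \<open>w\<close>, so \<open>phi\<close> is a homomorphism. That \<open>phi w\<close> lies in \<open>R(D)\<close> uses exactly
  that the lines through \<open>e\<close> form a rank 2 flat of the simple matroid \<open>W\<close>: at most one line through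
  \<open>e\<close> exceeds \<open>A\<close>, and \<open>A > m\<close> for at most one point \<open>e\<close>.

  Any two chips can be reached explicitly, by weights constant along a flag of flats of \<open>W\<close>; three
  chips on the lines of a basis of \<open>W\<close> cannot, as these lines would lie in a proper flat. Finally,
  the rows of a real matrix are tropically dependent unless, after shifting the rows, each of them
  is the unique minimum of some column; for rows with superlevel sets in \<open>flats W\<close> such columns form
  an independent set of \<open>W\<close>, so there are at most three of them.
\<close>

section \<open>Matroids\<close>

locale finite_matroid =
  fixes M :: "'a matroid"
  assumes matroid: "is_matroid M"
begin

lemma finite_ground: "finite (ground M)"
  and indep_ground: "I \<in> indep M \<Longrightarrow> I \<subseteq> ground M"
  and empty_indep: "{} \<in> indep M"
  and indep_subset: "I \<in> indep M \<Longrightarrow> J \<subseteq> I \<Longrightarrow> J \<in> indep M"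
  and augment: "I \<in> indep M \<Longrightarrow> J \<in> indep M \<Longrightarrow> card I < card J \<Longrightarrow> \<exists>x\<in>J - I. insert x I \<in> indep M"
  using matroid unfolding is_matroid_def by blast+

lemma finite_indep: "I \<in> indep M \<Longrightarrow> finite I"
  using finite_ground indep_ground finite_subset by blast

lemma finite_indep_sets: "finite {I \<in> indep M. I \<subseteq> X}"
  by (rule finite_subset[of _ "Pow (ground M)"]) (use indep_ground finite_ground in auto)

lemma card_le_rk: "I \<in> indep M \<Longrightarrow> I \<subseteq> X \<Longrightarrow> card I \<le> rk M X"
  unfolding rk_def by (rule Max_ge) (use finite_indep_sets in auto)

lemma rk_obtain:
  obtains I where "I \<in> indep M" "I \<subseteq> X" "card I = rk M X"
proof -
  have "rk M X \<in> card ` {I \<in> indep M. I \<subseteq> X}"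
    unfolding rk_def by (rule Max_in) (use finite_indep_sets empty_indep in auto)
  then show ?thesis using that by auto
qed

lemma rk_mono: "X \<subseteq> Y \<Longrightarrow> rk M X \<le> rk M Y"
  by (rule rk_obtain[of X]) (metis card_le_rk subset_trans)

lemma rk_le_card: "finite X \<Longrightarrow> rk M X \<le> card X"
  by (rule rk_obtain[of X]) (metis card_mono)

lemma extend_to_basis:
  assumes "I \<in> indep M" "I \<subseteq> X"
  shows "\<exists>J\<in>indep M. I \<subseteq> J \<and> J \<subseteq> X \<and> card J = rk M X"
  using assms
proof (induction "rk M X - card I" arbitrary: I rule: less_induct)
  case less
  show ?case
  proof (cases "card I = rk M X")
    case True
    then show ?thesis using less.prems by blast
  next
    case False
    then have lt: "card I < rk M X" using card_le_rk[OF less.prems] by simp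
    obtain K where K: "K \<in> indep M" "K \<subseteq> X" "card K = rk M X" by (rule rk_obtain)
    then obtain x where x: "x \<in> K - I" "insert x I \<in> indep M" using augment less.prems lt by metis
    have "card (insert x I) = Suc (card I)" using x finite_indep less.prems by auto
    then have "rk M X - card (insert x I) < rk M X - card I" using lt by simp
    moreover have "insert x I \<subseteq> X" using x K less.prems by auto
    ultimately show ?thesis using less.hyps[of "insert x I"] x by blast
  qed
qed

lemma flat_subset: "F \<in> flats M \<Longrightarrow> F \<subseteq> ground M"
  by (simp add: flats_def)

text \<open>Extend \<open>J\<close> to a basis of \<open>F\<close> and augment it from a basis of
  \<open>insert x F\<close>, which is larger; the added element cannot lie in \<open>F\<close>, so
  it is \<open>x\<close>. This is the main source of independent sets below.\<close>

lemma indep_insert_flat: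
  assumes "J \<in> indep M" "J \<subseteq> F" "F \<in> flats M" "x \<in> ground M" "x \<notin> F"
  shows "insert x J \<in> indep M"
proof -
  obtain B where B: "B \<in> indep M" "J \<subseteq> B" "B \<subseteq> F" "card B = rk M F"
    using extend_to_basis assms by blast
  obtain K where K: "K \<in> indep M" "K \<subseteq> insert x F" "card K = rk M (insert x F)" by (rule rk_obtain)
  have "card B < card K" using B K assms by (auto simp: flats_def)
  then obtain y where y: "y \<in> K - B" "insert y B \<in> indep M" using augment B K by blast
  have "y = x"
  proof (rule ccontr)
    assume "y \<noteq> x"
    then have "insert y B \<subseteq> F" using y K B by auto
    then have "card (insert y B) \<le> rk M F" using card_le_rk y by blast
    then show False using y B finite_indep by auto
  qed
  then show ?thesis using y B indep_subset by blast
qed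

text \<open>A partial converse of \<open>indep_insert_flat\<close>: testing one basis
  \<open>J\<close> of \<open>F\<close> suffices, since \<open>insert x J\<close> witnesses the
  growth of the rank.\<close>

lemma flatI:
  assumes "F \<subseteq> ground M" "J \<in> indep M" "J \<subseteq> F" "card J = rk M F"
    and "\<And>x. x \<in> ground M \<Longrightarrow> x \<notin> F \<Longrightarrow> insert x J \<in> indep M"
  shows "F \<in> flats M"
proof -
  have "rk M F < rk M (insert x F)" if "x \<in> ground M - F" for x
  proof -
    have "insert x J \<in> indep M" using that assms(5) by simp
    then have "card (insert x J) \<le> rk M (insert x F)"
      by (rule card_le_rk) (use assms(3) in blast)
    moreover have "x \<notin> J" using that assms(3) by blast
    ultimately show ?thesis using assms(2,4) finite_indep by simp
  qed
  then show ?thesis using assms by (simp add: flats_def)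
qed

text \<open>An element outside the intersection is outside one of the two flats, and relative to
  that flat it enlarges a basis of the intersection.\<close>

lemma flat_Int:
  assumes "F \<in> flats M" "G \<in> flats M"
  shows "F \<inter> G \<in> flats M"
proof -
  obtain J where J: "J \<in> indep M" "J \<subseteq> F \<inter> G" "card J = rk M (F \<inter> G)" by (rule rk_obtain)
  show ?thesis
  proof (rule flatI[of _ J])
    fix x assume "x \<in> ground M" "x \<notin> F \<inter> G"
    then consider "x \<notin> F" | "x \<notin> G" by blast
    then show "insert x J \<in> indep M"
      using indep_insert_flat[of J F x] indep_insert_flat[of J G x] J assms \<open>x \<in> ground M\<close>
      by cases simp_all
  qed (use J flat_subset assms in auto)
qed

section \<open>The closure operator\<close>

lemma ground_flat: "ground M \<in> flats M"
  by (simp add: flats_def)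

text \<open>Taken as an intersection of flats instead of through ranks, so that monotonicity and
  minimality are immediate; \<open>cl_indep\<close> recovers the usual description for independent
  sets.\<close>

definition cl :: "'a set \<Rightarrow> 'a set" where
  "cl X = \<Inter> {F \<in> flats M. X \<subseteq> F}"

lemma cl_flat:
  assumes "X \<subseteq> ground M"
  shows "cl X \<in> flats M"
proof -
  have fin: "finite (flats M)"
    by (rule finite_subset[of _ "Pow (ground M)"]) (use flat_subset finite_ground in auto)
  have "\<Inter> A \<in> flats M" if "finite A" "A \<noteq> {}" "A \<subseteq> flats M" for A
    using that by (induction rule: finite_ne_induct) (auto intro: flat_Int)
  moreover have "ground M \<in> {F \<in> flats M. X \<subseteq> F}" using ground_flat assms by simp
  ultimately show ?thesis unfolding cl_def using fin
    by (metis (no_types, lifting) empty_iff finite_subset mem_Collect_eq subsetI)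
qed

lemma cl_superset: "X \<subseteq> cl X"
  by (auto simp: cl_def)

lemma cl_least: "F \<in> flats M \<Longrightarrow> X \<subseteq> F \<Longrightarrow> cl X \<subseteq> F"
  by (auto simp: cl_def)

lemma cl_mono: "X \<subseteq> Y \<Longrightarrow> cl X \<subseteq> cl Y"
  by (auto simp: cl_def)

text \<open>The right-hand side has rank \<open>card I\<close>, because it is built so that
  \<open>I\<close> cannot be augmented inside it. Hence it is a flat, and
  \<open>indep_insert_flat\<close> puts it inside every flat containing \<open>I\<close>.\<close>

lemma cl_indep:
  assumes "I \<in> indep M"
  shows "cl I = {x \<in> ground M. x \<in> I \<or> insert x I \<notin> indep M}" (is "_ = ?C")
    and "rk M (cl I) = card I"
proof -
  have sub: "I \<subseteq> ?C" using indep_ground assms by blast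
  have rk: "rk M ?C = card I"
  proof (rule antisym)
    obtain K where K: "K \<in> indep M" "K \<subseteq> ?C" "card K = rk M ?C" by (rule rk_obtain)
    show "rk M ?C \<le> card I"
    proof (rule ccontr)
      assume "\<not> rk M ?C \<le> card I"
      then obtain x where "x \<in> K - I" "insert x I \<in> indep M"
        using augment[OF assms K(1)] K by auto
      then show False using K by auto
    qed
  qed (use sub assms card_le_rk in blast)
  have "?C \<in> flats M"
    by (rule flatI[of _ I]) (use sub rk assms in auto)
  then have "cl I \<subseteq> ?C" using cl_least sub by blast
  moreover have "?C \<subseteq> F" if "F \<in> flats M" "I \<subseteq> F" for F
    using that indep_insert_flat assms by blast
  then have "?C \<subseteq> cl I" by (auto simp: cl_def)
  ultimately show "cl I = ?C" by blast
  then show "rk M (cl I) = card I" using rk by simp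
qed

text \<open>Mac Lane-Steinitz exchange over a flat. For a basis \<open>J\<close> of
  \<open>F\<close>, failure of the conclusion makes \<open>J\<close> together with \<open>y\<close>
  and \<open>x\<close> independent; but \<open>F\<close> lies in \<open>cl J\<close>, so
  \<open>y\<close> lies in \<open>cl (insert x J)\<close>, a contradiction.\<close>

lemma cl_exchange:
  assumes F: "F \<in> flats M" and xy: "x \<in> ground M" "y \<in> ground M" "y \<notin> F" "y \<in> cl (insert x F)"
  shows "x \<in> cl (insert y F)"
proof (rule ccontr)
  assume neg: "x \<notin> cl (insert y F)"
  obtain J where J: "J \<in> indep M" "J \<subseteq> F" "card J = rk M F" by (rule rk_obtain)
  have iF: "insert y F \<subseteq> ground M" "insert x F \<subseteq> ground M" using F flat_subset xy by auto
  have "insert y J \<in> indep M" using indep_insert_flat J F xy by blast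
  moreover have "insert y J \<subseteq> cl (insert y F)"
    using J cl_superset[of "insert y F"] by blast
  ultimately have "insert x (insert y J) \<in> indep M"
    using indep_insert_flat cl_flat[OF iF(1)] neg xy(1) by blast
  then have i3: "insert y (insert x J) \<in> indep M" by (simp add: insert_commute)
  have xJ: "insert x J \<in> indep M" using i3 indep_subset by blast
  have xF: "x \<notin> F" using neg cl_superset[of "insert y F"] by blast
  have "F \<subseteq> cl J" using J F
  proof -
    have "insert z J \<notin> indep M" if "z \<in> F" "z \<notin> J" for z
    proof
      assume "insert z J \<in> indep M"
      then have "card (insert z J) \<le> rk M F" using card_le_rk that J by simp
      then show False using that J finite_indep by simp
    qed
    then show ?thesis using cl_indep(1)[OF J(1)] F flat_subset by blast
  qed
  then have "insert x F \<subseteq> cl (insert x J)"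
    using cl_mono[of J "insert x J"] cl_superset[of "insert x J"] by blast
  then have "y \<in> cl (insert x J)"
    using xy(4) cl_least[OF cl_flat[OF indep_ground[OF xJ]]] by blast
  moreover have "y \<notin> insert x J" using xy J neg cl_superset[of "insert y F"] by blast
  ultimately show False using cl_indep(1)[OF xJ] i3 by simp
qed

lemma flat_eqI:
  assumes "F \<in> flats M" "G \<in> flats M" "F \<subseteq> G" "rk M F = rk M G"
  shows "F = G"
proof (rule ccontr)
  assume "F \<noteq> G"
  then obtain x where x: "x \<in> G" "x \<notin> F" using assms by blast
  then have "rk M F < rk M (insert x F)" using assms(1,2) flat_subset[of G] by (auto simp: flats_def)
  also have "\<dots> \<le> rk M G" using rk_mono x assms by simp
  finally show False using assms by simp
qed

lemma rk_proper_flat: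
  assumes "F \<in> flats M" "F \<noteq> ground M"
  shows "rk M F < matroid_rank M"
  using assms flat_eqI[OF assms(1) ground_flat] rk_mono[of F "ground M"] flat_subset[OF assms(1)]
  unfolding matroid_rank_def by linarith

end

text \<open>A matroidal linear series asks for a valuated matroid indexed by natural numbers, while
  the elements of an adjoint are lines; relabelling bridges the two.\<close>

lemma matroid_transport:
  fixes W :: "'a matroid" and g :: "'a \<Rightarrow> 'b"
  assumes W: "is_matroid W" and inj: "inj_on g (ground W)"
  obtains U :: "'b matroid" where "is_matroid U" "ground U = g ` ground W"
    "matroid_rank U = matroid_rank W"
    "\<And>X. X \<subseteq> ground W \<Longrightarrow> g ` X \<in> flats U \<longleftrightarrow> X \<in> flats W"
proof -
  interpret W: finite_matroid W by unfold_locales (rule W)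
  define U where "U = \<lparr>ground = g ` ground W, indep = (\<lambda>I. g ` I) ` indep W\<rparr>"
  have card: "card (g ` I) = card I" if "I \<subseteq> ground W" for I
    using card_image inj_on_subset[OF inj that] by blast
  have sub: "g ` I \<subseteq> g ` J \<longleftrightarrow> I \<subseteq> J" if "I \<subseteq> ground W" "J \<subseteq> ground W" for I J
    using inj that unfolding inj_on_def by blast
  have "is_matroid U" unfolding is_matroid_def
  proof (intro conjI ballI allI impI)
    show "finite (ground U)" using W.finite_ground by (simp add: U_def)
    show "indep U \<subseteq> Pow (ground U)" using W.indep_ground by (auto simp: U_def)
    show "{} \<in> indep U" using W.empty_indep by (auto simp: U_def)
  next
    fix I J assume "I \<in> indep U" "J \<subseteq> I"
    then obtain I' where I': "I' \<in> indep W" "I = g ` I'" by (auto simp: U_def)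
    then obtain J' where "J' \<subseteq> I'" "J = g ` J'" using \<open>J \<subseteq> I\<close> by (meson subset_imageE)
    then show "J \<in> indep U" using I' W.indep_subset by (auto simp: U_def)
  next
    fix I J assume "I \<in> indep U" "J \<in> indep U" "card I < card J"
    then obtain I' J' where IJ: "I' \<in> indep W" "I = g ` I'" "J' \<in> indep W" "J = g ` J'"
      by (auto simp: U_def)
    then have "card I' < card J'" using \<open>card I < card J\<close> card W.indep_ground by metis
    then obtain x where x: "x \<in> J' - I'" "insert x I' \<in> indep W" using W.augment IJ by blast
    have "I' \<subseteq> ground W" "J' \<subseteq> ground W" using IJ W.indep_ground by auto
    then have "g x \<notin> I" using x(1) IJ(2) inj unfolding inj_on_def by blast
    moreover have "insert (g x) I \<in> indep U" using x IJ by (auto simp: U_def intro!: image_eqI[of _ _ "insert x I'"])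
    ultimately show "\<exists>x\<in>J - I. insert x I \<in> indep U" using x IJ by blast
  qed
  moreover have rk: "rk U (g ` X) = rk W X" if X: "X \<subseteq> ground W" for X
  proof -
    have "card ` {I \<in> indep U. I \<subseteq> g ` X} = card ` {I \<in> indep W. I \<subseteq> X}"
    proof -
      have "{I \<in> indep U. I \<subseteq> g ` X} = (\<lambda>I. g ` I) ` {I \<in> indep W. I \<subseteq> X}"
        using sub[OF W.indep_ground X] by (auto simp: U_def)
      moreover have "(\<lambda>I. card (g ` I)) ` {I \<in> indep W. I \<subseteq> X} = card ` {I \<in> indep W. I \<subseteq> X}"
        by (rule image_cong) (use card W.indep_ground in auto)
      ultimately show ?thesis by (simp add: image_image)
    qed
    then show ?thesis by (simp add: rk_def)
  qed
  moreover have "matroid_rank U = matroid_rank W"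
    unfolding matroid_rank_def using rk[of "ground W"] by (simp add: U_def)
  moreover have "g ` X \<in> flats U \<longleftrightarrow> X \<in> flats W" if X: "X \<subseteq> ground W" for X
  proof -
    have "ground U - g ` X = g ` (ground W - X)"
      using X inj unfolding inj_on_def U_def by auto
    moreover have "rk U (insert (g x) (g ` X)) = rk W (insert x X)" if "x \<in> ground W" for x
      using rk[of "insert x X"] that X by simp
    moreover have "g ` X \<subseteq> ground U" using X by (auto simp: U_def)
    ultimately show ?thesis using X rk[OF X] by (simp add: flats_def)
  qed
  moreover have "ground U = g ` ground W" by (simp add: U_def)
  ultimately show ?thesis by (intro that[of U])
qed

section \<open>The valuated matroid of a matroid with trivial valuation\<close>

text \<open>This is the tropical linear space of \<open>U\<close> (its Bergman fan with points at
  infinity). The level \<open>c\<close> is an extended real: \<open>c = \<infinity>\<close> forces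
  the set of infinite entries to be a flat, which determines the rank of the valuated
  matroid.\<close>

definition flag_vectors :: "'b matroid \<Rightarrow> ('b \<Rightarrow> ereal) set" where
  "flag_vectors U = {w \<in> ground U \<rightarrow>\<^sub>E {x. x \<noteq> -\<infinity>}. \<forall>c. {i \<in> ground U. c \<le> w i} \<in> flats U}"

context finite_matroid
begin

lemma tmin_flag_vectors:
  assumes "w \<in> flag_vectors M" "w' \<in> flag_vectors M"
  shows "tmin (ground M) w w' \<in> flag_vectors M"
proof -
  have "{i \<in> ground M. c \<le> tmin (ground M) w w' i} =
      {i \<in> ground M. c \<le> w i} \<inter> {i \<in> ground M. c \<le> w' i}" for c
    by (auto simp: tmin_def)
  then show ?thesis using assms flat_Int
    by (auto simp: flag_vectors_def tmin_def PiE_iff min_def)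
qed

lemma tscale_flag_vectors:
  assumes w: "w \<in> flag_vectors M" and a: "a \<noteq> -\<infinity>"
  shows "tscale (ground M) a w \<in> flag_vectors M"
proof -
  have "{i \<in> ground M. c \<le> tscale (ground M) a w i} \<in> flats M" for c
  proof (cases a)
    case (real r)
    have "{i \<in> ground M. c \<le> tscale (ground M) a w i} = {i \<in> ground M. c - ereal r \<le> w i}"
      by (auto simp: tscale_def real ereal_minus_le)
    then show ?thesis using w by (simp add: flag_vectors_def)
  next
    case PInf
    have "{i \<in> ground M. c \<le> tscale (ground M) a w i} = ground M"
      using w by (auto simp: tscale_def PInf)
    then show ?thesis using ground_flat by simp
  qed (use a in simp)
  then show ?thesis using w a by (auto simp: flag_vectors_def tscale_def PiE_iff)
qed

text \<open>Above the common value of \<open>w i\<close> and \<open>w' i\<close>, the superlevel sets of the vector that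
  eliminates \<open>i\<close> are the closures of \<open>i\<close> with the superlevel sets of the minimum.\<close>

lemma flag_vectors_elimination:
  assumes w: "w \<in> flag_vectors M" and w': "w' \<in> flag_vectors M"
    and i: "i \<in> ground M" and eq: "w i = w' i"
  shows "\<exists>v\<in>flag_vectors M. v i = \<infinity> \<and> (\<forall>j\<in>ground M - {i}. min (w j) (w' j) \<le> v j \<and>
      (w j \<noteq> w' j \<longrightarrow> v j = min (w j) (w' j)))"
proof -
  define u where "u = tmin (ground M) w w'"
  have u: "u \<in> flag_vectors M" unfolding u_def by (rule tmin_flag_vectors[OF w w'])
  have uj: "u j = min (w j) (w' j)" if "j \<in> ground M" for j using that by (simp add: u_def tmin_def)
  define X where "X l = {j \<in> ground M. l \<le> u j}" for l
  \<comment> \<open>Up to the common value \<open>w i\<close> the level set contains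
    \<open>i\<close> already and stays unchanged.\<close>
  define Z where "Z l = (if l \<le> w i then X l else cl (insert i (X l)))" for l
  have Xf: "X l \<in> flats M" for l using u by (simp add: X_def flag_vectors_def)
  have iX: "insert i (X l) \<subseteq> ground M" for l using i by (auto simp: X_def)
  have Zf: "Z l \<in> flats M" for l using Xf cl_flat[OF iX] by (simp add: Z_def)
  have XZ: "X l \<subseteq> Z l" for l using cl_superset[of "insert i (X l)"] by (auto simp: Z_def)
  have iZ: "i \<in> Z l" for l
    using cl_superset[of "insert i (X l)"] i uj[OF i] eq by (auto simp: Z_def X_def)
  have X_anti: "X l' \<subseteq> X l" if "l \<le> l'" for l l' using that by (auto simp: X_def)
  have Z_anti: "Z l' \<subseteq> Z l" if "l \<le> l'" for l l'
  proof (cases "l' \<le> w i")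
    case True
    then have "l \<le> w i" using that by order
    then show ?thesis using X_anti[OF that] True by (simp add: Z_def)
  next
    case l': False
    show ?thesis
    proof (cases "l \<le> w i")
      case True
      have "i \<in> X l" using True i uj[OF i] eq by (simp add: X_def)
      then have "cl (insert i (X l')) \<subseteq> X l" using cl_least[OF Xf] X_anti[OF that] by blast
      then show ?thesis using True l' by (simp add: Z_def)
    next
      case False
      then show ?thesis using l' cl_mono[of "insert i (X l')" "insert i (X l)"] X_anti[OF that]
        by (auto simp: Z_def)
    qed
  qed
  \<comment> \<open>Enlarging the level sets must not lift \<open>j\<close> where the two vectors
    differ. Here \<open>v\<close> is the one that is smaller at \<open>j\<close>, so that both
    orders of \<open>w\<close> and \<open>w'\<close> are covered.\<close>
  have key: "l \<le> u j"
    if v: "v \<in> flag_vectors M" "v' \<in> flag_vectors M" "v i = w i" "v' i = w i"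
      and uv: "\<And>k. k \<in> ground M \<Longrightarrow> u k = min (v k) (v' k)"
      and j: "j \<in> ground M" "v j < v' j" "j \<in> Z l" for v v' j l
  proof (rule ccontr)
    assume neg: "\<not> l \<le> u j"
    then have lw: "\<not> l \<le> w i" using j by (auto simp: Z_def X_def)
    then have jcl: "j \<in> cl (insert i (X l))" using j by (simp add: Z_def)
    have vj: "v j < l" using neg uv[OF j(1)] j(2) by (simp add: not_le min_absorb1 less_imp_le)
    show False
    proof (cases "v' j \<le> w i")
      case True
      have "insert i (X l) \<subseteq> {k \<in> ground M. v' j \<le> v k}"
        using True lw i v uv by (auto simp: X_def)
      then have "cl (insert i (X l)) \<subseteq> {k \<in> ground M. v' j \<le> v k}"
        using cl_least v by (simp add: flag_vectors_def)
      then show False using jcl j by auto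
    next
      case False
      \<comment> \<open>At level \<open>l'\<close> the entry \<open>v' j\<close> is high enough but
        \<open>u j\<close> is too low, so exchange moves \<open>i\<close> into a superlevel set of
        \<open>v'\<close>, against \<open>v' i = w i < l'\<close>.\<close>
      define l' where "l' = min l (v' j)"
      have l': "\<not> l' \<le> w i" "l' \<le> l" "l' \<le> v' j" "v j < l'"
        using False lw vj j by (auto simp: l'_def min_le_iff_disj)
      have "j \<notin> X l'" using l'(4) uv[OF j(1)] j(2) by (auto simp: X_def min_def)
      moreover have "j \<in> cl (insert i (X l'))"
        using jcl cl_mono[of "insert i (X l)" "insert i (X l')"] X_anti[OF l'(2)] by blast
      ultimately have "i \<in> cl (insert j (X l'))" using cl_exchange[OF Xf i j(1)] by blast
      moreover have "insert j (X l') \<subseteq> {k \<in> ground M. l' \<le> v' k}"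
        using j l' uv by (auto simp: X_def)
      then have "cl (insert j (X l')) \<subseteq> {k \<in> ground M. l' \<le> v' k}"
        using cl_least v by (simp add: flag_vectors_def)
      ultimately show False using l' v by auto
    qed
  qed
  have le: "l \<le> u j" if "j \<in> ground M" "w j \<noteq> w' j" "j \<in> Z l" for j l
  proof (cases "w j < w' j")
    case True
    show ?thesis by (rule key[OF w w' refl eq[symmetric] uj that(1) True that(3)])
  next
    case False
    then have "w' j < w j" using that by simp
    show ?thesis
      by (rule key[OF w' w eq[symmetric] refl _ that(1) \<open>w' j < w j\<close> that(3)])
        (simp add: uj min.commute)
  qed
  \<comment> \<open>Finitely many levels suffice. The level \<open>\<infinity>\<close> is included
    because \<open>i\<close> lies in every \<open>Z l\<close>, which gives
    \<open>v i = \<infinity>\<close>.\<close>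
  define \<Lambda> where "\<Lambda> = insert \<infinity> (u ` ground M)"
  have finL: "finite \<Lambda>" using finite_ground by (simp add: \<Lambda>_def)
  define v where "v = (\<lambda>j\<in>ground M. Max {l \<in> \<Lambda>. j \<in> Z l})"
  have mem: "u j \<in> {l \<in> \<Lambda>. j \<in> Z l}" if "j \<in> ground M" for j
    using that XZ[of "u j"] by (auto simp: \<Lambda>_def X_def)
  have v_iff: "c \<le> v j \<longleftrightarrow> (\<exists>l\<in>\<Lambda>. j \<in> Z l \<and> c \<le> l)" if "j \<in> ground M" for j c
  proof -
    have "finite {l \<in> \<Lambda>. j \<in> Z l}" "{l \<in> \<Lambda>. j \<in> Z l} \<noteq> {}" using finL mem[OF that] by auto
    then show ?thesis using that Max_ge_iff[of "{l \<in> \<Lambda>. j \<in> Z l}" c] by (auto simp: v_def)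
  qed
  have uv: "u j \<le> v j" if "j \<in> ground M" for j using mem[OF that] v_iff[OF that] by auto
  have "v \<in> flag_vectors M"
    unfolding flag_vectors_def
  proof (intro CollectI conjI allI)
    have "u j \<noteq> -\<infinity>" if "j \<in> ground M" for j using u that by (auto simp: flag_vectors_def PiE_iff)
    then have "v j \<noteq> -\<infinity>" if "j \<in> ground M" for j using uv[OF that] that by auto
    then show "v \<in> ground M \<rightarrow>\<^sub>E {x. x \<noteq> -\<infinity>}"
      by (simp add: PiE_iff v_def)
  next
    fix c
    \<comment> \<open>Since \<open>Z\<close> is decreasing, the superlevel set of \<open>v\<close>
      at \<open>c\<close> is \<open>Z\<close> at the least level of \<open>\<Lambda>\<close> that is
      at least \<open>c\<close>.\<close>
    define l where "l = Min {l \<in> \<Lambda>. c \<le> l}"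
    have "l \<in> {l \<in> \<Lambda>. c \<le> l}" unfolding l_def using finL by (intro Min_in) (auto simp: \<Lambda>_def)
    moreover have "l \<le> l'" if "l' \<in> \<Lambda>" "c \<le> l'" for l'
      unfolding l_def using finL that by (intro Min_le) auto
    ultimately have "{j \<in> ground M. c \<le> v j} = Z l"
      using v_iff Z_anti flat_subset[OF Zf] by blast
    then show "{j \<in> ground M. c \<le> v j} \<in> flats M" using Zf by simp
  qed
  moreover have "\<infinity> \<le> v i" unfolding v_iff[OF i] using iZ by (auto simp: \<Lambda>_def)
  moreover have "v j = min (w j) (w' j)" if "j \<in> ground M" "w j \<noteq> w' j" for j
  proof (rule antisym)
    show "v j \<le> min (w j) (w' j)"
      using v_iff[OF that(1), of "v j"] le[OF that] uj[OF that(1)] by force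
  qed (use uv uj that in force)
  ultimately show ?thesis using uv uj by (intro bexI[of _ v]) auto
qed

lemma valuated_matroid_flag_vectors: "valuated_matroid (ground M) (flag_vectors M)"
  unfolding valuated_matroid_def
proof (intro conjI ballI allI impI)
  have "(\<lambda>i\<in>ground M. \<infinity>) \<in> flag_vectors M"
    by (auto simp: flag_vectors_def ground_flat)
  then show "flag_vectors M \<noteq> {}" by blast
qed (use finite_ground tmin_flag_vectors tscale_flag_vectors flag_vectors_elimination in
    \<open>simp_all add: flag_vectors_def subset_iff\<close>)

text \<open>Covectors are complements of flats: a flat is the set of infinite entries of the vector
  that is \<infinity> on it and 0 elsewhere, and conversely that set is the superlevel set at
  \<infinity>.\<close>

lemma flag_vectors_rank: "valuated_matroid_has_rank (ground M) (flag_vectors M) (matroid_rank M)"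
  unfolding valuated_matroid_has_rank_def
proof (intro exI conjI set_eqI iffI)
  fix X assume "X \<in> {ground M - F |F. F \<in> flats M}"
  then obtain F where F: "F \<in> flats M" "X = ground M - F" by blast
  define w :: "'a \<Rightarrow> ereal" where "w = (\<lambda>i\<in>ground M. if i \<in> F then \<infinity> else 0)"
  have "{i \<in> ground M. c \<le> w i} = (if c \<le> 0 then ground M else F)" for c
    using flat_subset[OF F(1)] by (auto simp: w_def split: if_splits)
  then have "w \<in> flag_vectors M"
    using F ground_flat by (auto simp: flag_vectors_def w_def)
  moreover have "X = {i \<in> ground M. w i \<noteq> \<infinity>}" using F by (auto simp: w_def)
  ultimately show "X \<in> {{i \<in> ground M. w i \<noteq> \<infinity>} |w. w \<in> flag_vectors M}" by blast
next
  fix X assume "X \<in> {{i \<in> ground M. w i \<noteq> \<infinity>} |w. w \<in> flag_vectors M}"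
  then obtain w where w: "w \<in> flag_vectors M" "X = {i \<in> ground M. w i \<noteq> \<infinity>}" by blast
  then have "{i \<in> ground M. \<infinity> \<le> w i} \<in> flats M" by (simp only: flag_vectors_def) blast
  moreover have "X = ground M - {i \<in> ground M. \<infinity> \<le> w i}" using w by auto
  ultimately show "X \<in> {ground M - F |F. F \<in> flats M}" by blast
qed (use matroid in auto)

end

section \<open>Tropical dependence of the rows of a matrix\<close>

text \<open>Tropical dependence phrased row by row: after the shifts no row is alone at the minimum
  of a column. This is the condition that the operator \<open>T\<close> of the next proof
  tests.\<close>

definition rows_dependent :: "'k set \<Rightarrow> 'i set \<Rightarrow> ('k \<Rightarrow> 'i \<Rightarrow> real) \<Rightarrow> bool" where
  "rows_dependent K N w \<longleftrightarrow>
     (\<exists>a. \<forall>k\<in>K. \<forall>i\<in>N. \<exists>l\<in>K - {k}. a l + w l i \<le> a k + w k i)"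

text \<open>\<open>T k a\<close> is the least shift of row \<open>k\<close> at which it is nowhere a
  unique minimum, so dependence means \<open>T a \<le> a\<close> for some \<open>a\<close>. Iterate
  \<open>max a (T a)\<close> from 0. If some coordinate stays bounded, the limits of the bounded
  coordinates and late values of the others solve \<open>T a \<le> a\<close>. Otherwise all
  coordinates grow without bound, and finitely many iterates combine to some \<open>y\<close> with
  \<open>y < T y\<close>: every row is alone at the minimum of some column.\<close>

lemma rows_dependent_or_separated:
  fixes w :: "'k \<Rightarrow> 'i \<Rightarrow> real"
  assumes fin: "finite K" "finite N" and N: "N \<noteq> {}" and K2: "2 \<le> card K"
    and indep: "\<not> rows_dependent K N w"
  obtains y i where "\<And>k. k \<in> K \<Longrightarrow> i k \<in> N"
    "\<And>k l. k \<in> K \<Longrightarrow> l \<in> K \<Longrightarrow> l \<noteq> k \<Longrightarrow> y k + w k (i k) < y l + w l (i k)"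
proof -
  define T where "T k a = Max ((\<lambda>i. Min ((\<lambda>l. a l + w l i) ` (K - {k})) - w k i) ` N)" for k a
  have ne: "K - {k} \<noteq> {}" if "k \<in> K" for k
  proof
    assume "K - {k} = {}"
    then have "K = {k}" using that by blast
    then have "card K = 1" by simp
    then show False using K2 by linarith
  qed
  have T_le: "T k a \<le> z \<longleftrightarrow> (\<forall>i\<in>N. \<exists>l\<in>K - {k}. a l + w l i \<le> z + w k i)" if "k \<in> K" for k a z
    unfolding T_def using fin N ne[OF that]
    by (subst Max_le_iff) (auto simp: Min_le_iff diff_le_eq)
  have T_mono: "T k a \<le> T k b + c" if k: "k \<in> K" and ab: "\<And>l. l \<in> K \<Longrightarrow> a l \<le> b l + c" for k a b c
    unfolding T_le[OF k]
  proof
    fix i assume "i \<in> N"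
    then obtain l where "l \<in> K - {k}" "b l + w l i \<le> T k b + w k i"
      using T_le[OF k, of b "T k b"] by auto
    then show "\<exists>l\<in>K - {k}. a l + w l i \<le> T k b + c + w k i"
      using ab[of l] by (intro bexI[of _ l]) auto
  qed
  define Q where "Q a k = max (a k) (T k a)" for a k
  define s where "s n = (Q ^^ n) (\<lambda>_. 0)" for n
  have s_Suc: "s (Suc n) k = max (s n k) (T k (s n))" for n k by (simp add: s_def Q_def)
  have inc: "incseq (\<lambda>n. s n k)" for k by (rule incseq_SucI) (simp add: s_Suc)
  define J where "J = {k \<in> K. bdd_above (range (\<lambda>n. s n k))}"
  have "J = {}"
  proof (rule ccontr)
    assume "J \<noteq> {}"
    then obtain k0 where k0: "k0 \<in> J" by blast
    define L where "L k = (SUP n. s n k)" for k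
    have sL: "s n k \<le> L k" if "k \<in> J" for n k
      unfolding L_def using that by (auto simp: J_def intro: cSUP_upper)
    have unb: "\<exists>n. \<forall>m\<ge>n. z < s m k" if "k \<in> K - J" for k z
    proof -
      have "\<not> bdd_above (range (\<lambda>n. s n k))" using that by (simp add: J_def)
      then obtain n where "z < s n k"
        by (meson bdd_aboveI2 linorder_not_le)
      then show ?thesis using incseqD[OF inc] by (meson less_le_trans)
    qed
    \<comment> \<open>From the shift \<open>R k\<close> on, row \<open>k\<close> is nowhere below
      row \<open>k0\<close> shifted by its limit, so an unbounded row needs no limit
      argument.\<close>
    define R where "R k = Max ((\<lambda>i. L k0 + w k0 i - w k i) ` N)" for k
    have R: "L k0 + w k0 i \<le> R k + w k i" if "i \<in> N" for k i
    proof -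
      have "L k0 + w k0 i - w k i \<le> R k" unfolding R_def using fin that by (intro Max_ge) auto
      then show ?thesis by simp
    qed
    have "\<forall>k\<in>K - J. \<exists>n. \<forall>m\<ge>n. R k < s m k" using unb by blast
    then obtain n where n: "\<And>k m. k \<in> K - J \<Longrightarrow> n k \<le> m \<Longrightarrow> R k < s m k" by metis
    define n0 where "n0 = Max (insert 0 (n ` K))"
    have n0: "n k \<le> n0" if "k \<in> K" for k unfolding n0_def using fin that by (intro Max_ge) auto
    \<comment> \<open>Bounded rows get their limits; unbounded rows are frozen at a time
      \<open>n0\<close> when all of them have passed \<open>R\<close>.\<close>
    define b where "b k = (if k \<in> J then L k else s n0 k)" for k
    have "\<exists>l\<in>K - {k}. b l + w l i \<le> b k + w k i" if k: "k \<in> K" and i: "i \<in> N" for k i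
    proof (cases "k \<in> J")
      case True
      have "T k b \<le> L k + \<epsilon>" if e: "\<epsilon> > 0" for \<epsilon>
      proof -
        have "\<exists>n. \<forall>m\<ge>n. L j \<le> s m j + \<epsilon>" if "j \<in> J" for j
        proof -
          have "\<exists>n. L j - \<epsilon> < s n j"
            using less_cSUP_iff[of UNIV "\<lambda>n. s n j" "L j - \<epsilon>"] that e
            by (simp add: J_def L_def)
          then obtain n where "L j - \<epsilon> < s n j" by blast
          then have "L j - \<epsilon> < s m j" if "n \<le> m" for m
            using incseqD[OF inc that, of j] by linarith
          then show ?thesis by (meson diff_le_eq less_imp_le)
        qed
        then have "\<forall>j\<in>J. \<exists>n. \<forall>m\<ge>n. L j \<le> s m j + \<epsilon>" by blast
        then obtain n' where n': "\<And>j m. j \<in> J \<Longrightarrow> n' j \<le> m \<Longrightarrow> L j \<le> s m j + \<epsilon>" by metis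
        \<comment> \<open>At time \<open>N'\<close> the bounded coordinates are within
          \<open>\<epsilon>\<close> of their limits and the others are at least their frozen values,
          so monotonicity of \<open>T\<close> compares \<open>b\<close> with
          \<open>s N'\<close>.\<close>
        define N' where "N' = Max (insert n0 (n' ` J))"
        have finJ: "finite J" using fin by (simp add: J_def)
        have N'1: "n0 \<le> N'" unfolding N'_def using finJ by (intro Max_ge) auto
        have N'2: "n' j \<le> N'" if "j \<in> J" for j unfolding N'_def using finJ that by (intro Max_ge) auto
        have "b j \<le> s N' j + \<epsilon>" if "j \<in> K" for j
          using n'[OF _ N'2] incseqD[OF inc N'1, of j] e by (auto simp: b_def)
        then have "T k b \<le> T k (s N') + \<epsilon>" using T_mono[OF k] by blast
        also have "T k (s N') \<le> s (Suc N') k" by (simp add: s_Suc)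
        also have "\<dots> \<le> L k" using sL True by blast
        finally show ?thesis by simp
      qed
      then have "T k b \<le> L k" by (rule field_le_epsilon)
      then show ?thesis using T_le[OF k] i True by (simp add: b_def)
    next
      case False
      have "b k0 + w k0 i \<le> R k + w k i" using R[OF i] k0 by (simp add: b_def)
      also have "\<dots> \<le> b k + w k i" using n[of k n0] n0 k False by (auto simp: b_def intro: less_imp_le)
      finally show ?thesis using k0 False by (intro bexI[of _ k0]) (auto simp: J_def)
    qed
    then show False using indep unfolding rows_dependent_def by blast
  qed
  have "\<forall>k\<in>K. \<exists>n. 1 \<le> s n k"
    using \<open>J = {}\<close> unfolding J_def
    by (metis (mono_tags, lifting) bdd_aboveI2 empty_iff linorder_le_cases mem_Collect_eq)
  then obtain n where n: "\<And>k. k \<in> K \<Longrightarrow> 1 \<le> s (n k) k" by metis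
  define n1 where "n1 = Suc (Max (insert 0 (n ` K)))"
  have "n k \<le> n1" if "k \<in> K" for k
    unfolding n1_def using fin that by (intro le_SucI Max_ge) auto
  then have s1: "1 \<le> s n1 k" if "k \<in> K" for k
    using n[OF that] incseqD[OF inc, of "n k" n1 k] that by force
  have n1: "n1 > 0" by (simp add: n1_def)
  text \<open>The sawtooth maximum turns an increase by \<open>1\<close> after \<open>n1\<close> steps into an increase by
    \<open>1 / n1\<close> in a single step.\<close>
  define y where "y k = Max ((\<lambda>j. s j k - real j / real n1) ` {..<n1})" for k
  have y_ge: "s j k - real j / real n1 \<le> y k" if "j < n1" for j k
    unfolding y_def using that by (intro Max_ge) auto
  have "\<exists>j<n1. y k = s j k - real j / real n1" for k
  proof -
    have "y k \<in> (\<lambda>j. s j k - real j / real n1) ` {..<n1}"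
      unfolding y_def using n1 by (intro Max_in) auto
    then show ?thesis by blast
  qed
  then obtain j where j: "\<And>k. j k < n1" "\<And>k. y k = s (j k) k - real (j k) / real n1" by metis
  have Ty: "y k < T k y" if k: "k \<in> K" for k
  proof -
    have step: "s (Suc i) k - real i / real n1 \<le> max (y k) (T k y)" if "i < n1" for i
    proof -
      have "s i l \<le> y l + real i / real n1" for l using y_ge[OF that, of l] by simp
      then have "T k (s i) \<le> T k y + real i / real n1" using T_mono[OF k] by blast
      then show ?thesis using y_ge[OF that, of k] by (auto simp: s_Suc max_def)
    qed
    \<comment> \<open>A maximum at index 0 is beaten by the last step, since the total growth is at
      least 1 and the correction there is less than 1. A maximum at a later index is beaten by the
      step leading to it, whose correction is smaller by \<open>1 / n1\<close>.\<close>
    have "y k < max (y k) (T k y)"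
    proof (cases "j k = 0")
      case True
      then have "y k \<le> s n1 k - 1" using j(2)[of k] s1[OF k] by (simp add: s_def)
      also have "\<dots> < s (Suc (n1 - 1)) k - real (n1 - 1) / real n1" using n1 by (simp add: field_simps)
      also have "\<dots> \<le> max (y k) (T k y)" using step[of "n1 - 1"] n1 by simp
      finally show ?thesis .
    next
      case False
      then obtain i where i: "j k = Suc i" by (cases "j k") auto
      then have "y k < s (Suc i) k - real i / real n1" using j(2)[of k] n1 by (simp add: field_simps)
      also have "\<dots> \<le> max (y k) (T k y)" using step[of i] i j(1)[of k] by simp
      finally show ?thesis .
    qed
    then show ?thesis by (simp add: max_def split: if_splits)
  qed
  have "\<exists>i\<in>N. \<forall>l\<in>K. l \<noteq> k \<longrightarrow> y k + w k i < y l + w l i" if k: "k \<in> K" for k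
  proof -
    have "\<not> T k y \<le> y k" using Ty[OF k] by simp
    then show ?thesis unfolding T_le[OF k] by (simp add: not_le Bex_def Ball_def) blast
  qed
  then obtain i where "\<And>k. k \<in> K \<Longrightarrow> i k \<in> N"
    "\<And>k l. k \<in> K \<Longrightarrow> l \<in> K \<Longrightarrow> l \<noteq> k \<Longrightarrow> y k + w k (i k) < y l + w l (i k)"
    by metis
  then show ?thesis using that by blast
qed

section \<open>Slopes of a minimum of three affine functions\<close>

lemma right_slope_eqI:
  assumes "\<epsilon> > 0" "\<And>h. 0 \<le> h \<Longrightarrow> h \<le> \<epsilon> \<Longrightarrow> g (t + h) = g t + of_int s * h"
  shows "right_slope g t = s"
  unfolding right_slope_def
proof (rule the_equality)
  show "\<exists>\<epsilon>>0. \<forall>h\<in>{0..\<epsilon>}. g (t + h) = g t + of_int s * h" using assms by auto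
next
  fix s' assume "\<exists>\<epsilon>>0. \<forall>h\<in>{0..\<epsilon>}. g (t + h) = g t + of_int s' * h"
  then obtain d where d: "d > 0" "\<And>h. 0 \<le> h \<Longrightarrow> h \<le> d \<Longrightarrow> g (t + h) = g t + of_int s' * h" by auto
  define \<eta> where "\<eta> = min d \<epsilon>"
  have "0 < \<eta>" "\<eta> \<le> d" "\<eta> \<le> \<epsilon>" using d(1) assms(1) by (simp_all add: \<eta>_def)
  then show "s' = s" using d(2)[of \<eta>] assms(2)[of \<eta>] by simp
qed

lemma left_slope_eqI:
  assumes "\<epsilon> > 0" "\<And>h. 0 \<le> h \<Longrightarrow> h \<le> \<epsilon> \<Longrightarrow> g (t - h) = g t - of_int s * h"
  shows "left_slope g t = s"
  unfolding left_slope_def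
proof (rule the_equality)
  show "\<exists>\<epsilon>>0. \<forall>h\<in>{0..\<epsilon>}. g (t - h) = g t - of_int s * h" using assms by auto
next
  fix s' assume "\<exists>\<epsilon>>0. \<forall>h\<in>{0..\<epsilon>}. g (t - h) = g t - of_int s' * h"
  then obtain d where d: "d > 0" "\<And>h. 0 \<le> h \<Longrightarrow> h \<le> d \<Longrightarrow> g (t - h) = g t - of_int s' * h" by auto
  define \<eta> where "\<eta> = min d \<epsilon>"
  have "0 < \<eta>" "\<eta> \<le> d" "\<eta> \<le> \<epsilon>" using d(1) assms(1) by (simp_all add: \<eta>_def)
  then show "s' = s" using d(2)[of \<eta>] assms(2)[of \<eta>] by simp
qed

text \<open>Among the branches attaining the minimum at \<open>t\<close>, the one of smallest slope
  takes over to the right; in \<open>left_slope_min3\<close> the one of largest slope takes over to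
  the left. The order of the conditions settles ties accordingly.\<close>

lemma right_slope_min3:
  fixes x y z :: real
  assumes e: "\<epsilon> > 0" and g: "\<And>h. 0 \<le> h \<Longrightarrow> h \<le> \<epsilon> \<Longrightarrow> g (t + h) = min x (min (y + h) (z - h))"
  shows "right_slope g t = (if z \<le> x \<and> z \<le> y then -1 else if x \<le> y then 0 else 1)"
proof -
  have g0: "g t = min x (min y z)" using g[of 0] e by simp
  consider "z \<le> x" "z \<le> y" | "x \<le> y" "x < z" | "y < x" "y < z" by linarith
  then show ?thesis
  proof cases
    case 1
    have "right_slope g t = -1"
      by (rule right_slope_eqI[OF e]) (use 1 g g0 in auto)
    then show ?thesis using 1 by simp
  next
    case 2
    have "right_slope g t = 0"
      by (rule right_slope_eqI[of "min \<epsilon> (z - x)"]) (use 2 e g g0 in auto)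
    then show ?thesis using 2 by simp
  next
    case 3
    have "right_slope g t = 1"
      by (rule right_slope_eqI[of "min \<epsilon> (min (x - y) ((z - y) / 2))"]) (use 3 e g g0 in auto)
    then show ?thesis using 3 by simp
  qed
qed

lemma left_slope_min3:
  fixes x y z :: real
  assumes e: "\<epsilon> > 0" and g: "\<And>h. 0 \<le> h \<Longrightarrow> h \<le> \<epsilon> \<Longrightarrow> g (t - h) = min x (min (y - h) (z + h))"
  shows "left_slope g t = (if y \<le> x \<and> y \<le> z then 1 else if x \<le> z then 0 else -1)"
proof -
  have g0: "g t = min x (min y z)" using g[of 0] e by simp
  consider "y \<le> x" "y \<le> z" | "x \<le> z" "x < y" | "z < x" "z < y" by linarith
  then show ?thesis
  proof cases
    case 1
    have "left_slope g t = 1"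
      by (rule left_slope_eqI[OF e]) (use 1 g g0 in auto)
    then show ?thesis using 1 by simp
  next
    case 2
    have "left_slope g t = 0"
      by (rule left_slope_eqI[of "min \<epsilon> (y - x)"]) (use 2 e g g0 in auto)
    then show ?thesis using 2 by simp
  next
    case 3
    have "left_slope g t = -1"
      by (rule left_slope_eqI[of "min \<epsilon> (min (x - z) ((y - z) / 2))"]) (use 3 e g g0 in auto)
    then show ?thesis using 3 by simp
  qed
qed

lemma pl_on_min3:
  fixes x y z :: real
  assumes g: "\<And>t. 0 \<le> t \<Longrightarrow> t \<le> L \<Longrightarrow> g t = min x (min (y + t) (z - t))"
  shows "pl_on L g"
  unfolding pl_on_def
proof
  have "continuous_on {0..L} (\<lambda>t. min x (min (y + t) (z - t)))"
    by (intro continuous_intros)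
  then show "continuous_on {0..L} g"
    by (rule iffD1[OF continuous_on_cong, rotated 2]) (use g in auto)
  have side: "(\<forall>t\<in>{a<..<b}. t \<le> c) \<or> (\<forall>t\<in>{a<..<b}. c \<le> t)" if "c \<notin> {a<..<b}" for a b c :: real
    using that by auto
  \<comment> \<open>The breakpoints are among the three pairwise crossings of the branches; between
    consecutive ones a single branch is minimal.\<close>
  show "\<exists>B. finite B \<and> (\<forall>a b. 0 \<le> a \<and> a < b \<and> b \<le> L \<and> {a<..<b} \<inter> B = {} \<longrightarrow>
      (\<exists>(s::int) c. \<forall>t\<in>{a<..<b}. g t = of_int s * t + c))"
  proof (intro exI[of _ "{x - y, z - x, (z - y) / 2}"] conjI allI impI)
    fix a b assume ab: "0 \<le> a \<and> a < b \<and> b \<le> L \<and> {a<..<b} \<inter> {x - y, z - x, (z - y) / 2} = {}"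
    have gt: "g t = min x (min (y + t) (z - t))" if "t \<in> {a<..<b}" for t using g[of t] that ab by auto
    have "(\<forall>t\<in>{a<..<b}. t \<le> x - y) \<or> (\<forall>t\<in>{a<..<b}. x - y \<le> t)"
      "(\<forall>t\<in>{a<..<b}. t \<le> z - x) \<or> (\<forall>t\<in>{a<..<b}. z - x \<le> t)"
      "(\<forall>t\<in>{a<..<b}. t \<le> (z - y) / 2) \<or> (\<forall>t\<in>{a<..<b}. (z - y) / 2 \<le> t)"
      by (rule side, use ab in blast)+
    then consider "\<forall>t\<in>{a<..<b}. x \<le> y + t \<and> x \<le> z - t" | "\<forall>t\<in>{a<..<b}. y + t \<le> x \<and> y + t \<le> z - t"
      | "\<forall>t\<in>{a<..<b}. z - t \<le> x \<and> z - t \<le> y + t"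
      by (elim disjE) (fastforce simp: field_simps)+
    then show "\<exists>(s::int) c. \<forall>t\<in>{a<..<b}. g t = of_int s * t + c"
    proof cases
      case 1
      then show ?thesis using gt by (intro exI[of _ 0] exI[of _ x]) auto
    next
      case 2
      then show ?thesis using gt by (intro exI[of _ 1] exI[of _ y]) auto
    next
      case 3
      then show ?thesis using gt by (intro exI[of _ "-1"] exI[of _ z]) auto
    qed
  qed simp
qed

lemma finite_attains_min:
  fixes f :: "'b \<Rightarrow> 'c::linorder"
  assumes "finite S" "S \<noteq> {}"
  shows "\<exists>x\<in>S. \<forall>y\<in>S. f x \<le> f y"
  using arg_min_if_finite[OF assms, of f] by (intro bexI[of _ "arg_min_on f S"]) (auto simp: not_less)

lemma effective_degree_two:
  assumes D: "is_divisor G D" and eff: "effective D" and deg: "divisor_degree D = 2"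
  obtains p q where "p \<in> points G" "q \<in> points G"
    "D = (\<lambda>x. (if x = p then 1 else 0) + (if x = q then 1 else 0))"
proof -
  let ?S = "{x. D x \<noteq> 0}"
  have fin: "finite ?S" and sub: "?S \<subseteq> points G" using D by (auto simp: is_divisor_def)
  have nn: "0 \<le> D x" for x using eff by (simp add: effective_def)
  have sum: "(\<Sum>x\<in>?S. D x) = 2" using deg by (simp add: divisor_degree_def)
  then have "?S \<noteq> {}" by force
  then obtain p where p: "D p \<noteq> 0" by blast
  have rest: "(\<Sum>x\<in>?S - {p}. D x) = 2 - D p" using sum fin p by (simp add: sum_diff1)
  have nn': "0 \<le> (\<Sum>x\<in>?S - {p}. D x)" using nn by (simp add: sum_nonneg)
  have "D p = 1 \<or> D p = 2" using rest nn' nn[of p] p by linarith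
  then show ?thesis
  proof
    assume p2: "D p = 2"
    then have "D x = 0" if "x \<noteq> p" for x
      using rest fin nn that sum_nonneg_eq_0_iff[of "?S - {p}" D] by auto
    then show ?thesis using p2 sub by (intro that[of p p]) auto
  next
    assume p1: "D p = 1"
    then have "?S - {p} \<noteq> {}" using rest by (metis diff_numeral_special(9) one_add_one add_diff_cancel_left' sum.empty zero_neq_one)
    then obtain q where q: "D q \<noteq> 0" "q \<noteq> p" by blast
    have rest2: "(\<Sum>x\<in>?S - {p} - {q}. D x) = 1 - D q" using rest p1 fin q by (simp add: sum_diff1)
    have "0 \<le> (\<Sum>x\<in>?S - {p} - {q}. D x)" using nn by (simp add: sum_nonneg)
    then have q1: "D q = 1" using rest2 nn[of q] q by linarith
    then have "D x = 0" if "x \<noteq> p" "x \<noteq> q" for x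
      using rest2 fin nn that sum_nonneg_eq_0_iff[of "?S - {p} - {q}" D] by auto
    then show ?thesis using p1 q1 q sub p by (intro that[of p q]) auto
  qed
qed

section \<open>Functions on the Levi graph defined by an adjoint\<close>

locale levi_adjoint =
  fixes M :: "'a matroid" and W :: "'a set matroid" and l :: "'a \<times> 'a set \<Rightarrow> real"
  assumes matroid_M: "is_matroid M" and simple: "is_simple M" and rank3: "matroid_rank M = 3"
    and len: "\<And>e F. F \<in> rank_flats M 2 \<Longrightarrow> e \<in> F \<Longrightarrow> l (e, F) = 1"
    and adjoint: "is_adjoint M W"
begin

sublocale M: finite_matroid M
  by unfold_locales (rule matroid_M)

sublocale W: finite_matroid W
  by unfold_locales (use adjoint in \<open>simp add: is_adjoint_def\<close>)

abbreviation "H \<equiv> rank_flats M 2"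
abbreviation "G \<equiv> levi_graph M l"
abbreviation "D \<equiv> cartwright_divisor M"

section \<open>Flats of the adjoint that come from elements and lines\<close>

definition star :: "'a \<Rightarrow> 'a set set" where
  "star e = {F \<in> H. e \<in> F}"

lemma corank_1: "corank_flats M 1 = H"
  by (auto simp: corank_flats_def rank_flats_def rank3)

lemma ground_W: "ground W = H"
  and rank_W: "matroid_rank W = 3"
  and adjointD: "F \<in> rank_flats M k \<Longrightarrow> {X \<in> H. F \<subseteq> X} \<in> corank_flats W k"
  using adjoint unfolding is_adjoint_def corank_1 by (auto simp: rank3)

lemma finite_H: "finite H"
  using W.finite_ground ground_W by simp

lemma rk_H: "rk W H = 3"
  using rank_W by (simp add: matroid_rank_def ground_W)

lemma H_nonempty: "H \<noteq> {}"
  using rk_H W.rk_le_card[of "{}"] by auto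

lemma H_subset: "F \<in> H \<Longrightarrow> F \<subseteq> ground M"
  by (simp add: rank_flats_def flats_def)

lemma finite_line: "F \<in> H \<Longrightarrow> finite F"
  using H_subset M.finite_ground finite_subset by blast

lemma line_card: "F \<in> H \<Longrightarrow> 2 \<le> card F"
  using M.rk_le_card[of F] finite_line by (auto simp: rank_flats_def)

lemma indep_pair: "x \<in> ground M \<Longrightarrow> y \<in> ground M \<Longrightarrow> {x, y} \<in> indep M"
  using simple by (simp add: is_simple_def)

text \<open>As \<open>M\<close> is simple, \<open>{e}\<close> is a flat of rank 1; the adjoint
  condition turns it into a flat of corank 1, that is, of rank 2.\<close>

lemma star_flat:
  assumes e: "e \<in> ground M"
  shows "star e \<in> flats W" "rk W (star e) = 2"
proof -
  have i: "{e} \<in> indep M" using indep_pair[OF e e] by simp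
  have r: "rk M {e} = 1" using M.card_le_rk[OF i, of "{e}"] M.rk_le_card[of "{e}"] by simp
  have "{e} \<in> flats M"
    by (rule M.flatI[of _ "{e}"]) (use e i r indep_pair in auto)
  then have "{X \<in> H. {e} \<subseteq> X} \<in> corank_flats W 1" using r by (intro adjointD) (simp add: rank_flats_def)
  then show "star e \<in> flats W" "rk W (star e) = 2"
    using rank_W by (auto simp: corank_flats_def star_def)
qed

lemma finite_star: "finite (star e)"
  using finite_H by (simp add: star_def)

lemma star_card: "e \<in> ground M \<Longrightarrow> 2 \<le> card (star e)"
  using W.rk_le_card[OF finite_star, of e] star_flat(2) by simp

lemma star_nonempty: "e \<in> ground M \<Longrightarrow> star e \<noteq> {}"
  using star_card by fastforce

text \<open>The adjoint condition for the whole ground set of \<open>M\<close>, which lies in no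
  line. It says that \<open>W\<close> has no loops.\<close>

lemma empty_flat: "{} \<in> flats W"
proof -
  have "ground M \<in> rank_flats M 3"
    using M.ground_flat rank3 by (simp add: rank_flats_def matroid_rank_def)
  then have "{X \<in> H. ground M \<subseteq> X} \<in> corank_flats W 3" by (rule adjointD)
  moreover have "\<not> ground M \<subseteq> X" if "X \<in> H" for X
    using M.rk_mono[of "ground M" X] rank3 that by (auto simp: rank_flats_def matroid_rank_def)
  then have "{X \<in> H. ground M \<subseteq> X} = {}" by blast
  ultimately show ?thesis by (simp add: corank_flats_def)
qed

text \<open>Distinct lines are incomparable, so the adjoint condition for \<open>k = 2\<close>
  excludes parallel elements of \<open>W\<close>.\<close>

lemma singleton_flat:
  assumes F: "F \<in> H"
  shows "{F} \<in> flats W"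
proof -
  have "{X \<in> H. F \<subseteq> X} = {F}" using F M.flat_eqI by (fastforce simp: rank_flats_def)
  then show ?thesis using adjointD[OF F] by (simp add: corank_flats_def)
qed

lemma indep_two_lines:
  assumes "F1 \<in> H" "F2 \<in> H"
  shows "{F1, F2} \<in> indep W"
proof -
  have 1: "{F1} \<in> indep W"
    using W.indep_insert_flat[OF W.empty_indep _ empty_flat, of F1] assms ground_W by simp
  show ?thesis
  proof (cases "F1 = F2")
    case False
    then have "insert F2 {F1} \<in> indep W"
      using W.indep_insert_flat[OF 1 _ singleton_flat[OF assms(1)], of F2] assms ground_W by simp
    then show ?thesis by (simp add: insert_commute)
  qed (use 1 in simp)
qed

lemma two_lines:
  assumes "F1 \<in> H" "F2 \<in> H" "F1 \<noteq> F2"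
  shows "\<exists>P\<in>flats W. P \<noteq> H \<and> F1 \<in> P \<and> F2 \<in> P"
proof (intro bexI[of _ "W.cl {F1, F2}"] conjI)
  show "W.cl {F1, F2} \<in> flats W" using assms ground_W by (intro W.cl_flat) simp
  show "W.cl {F1, F2} \<noteq> H"
    using W.cl_indep(2)[OF indep_two_lines[OF assms(1,2)]] rk_H assms by auto
qed (use W.cl_superset[of "{F1, F2}"] in auto)

text \<open>Two distinct elements extend to a basis, and the line through \<open>e\<close> and the
  third basis element avoids \<open>e'\<close>. This makes \<open>star\<close> injective.\<close>

lemma star_separates:
  assumes e: "e \<in> ground M" "e' \<in> ground M" "e \<noteq> e'"
  shows "\<exists>F\<in>star e. e' \<notin> F"
proof -
  have "{e, e'} \<subseteq> ground M" using e by simp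
  then obtain B where B: "B \<in> indep M" "{e, e'} \<subseteq> B" "card B = 3"
    using M.extend_to_basis[OF indep_pair[OF e(1,2)]] rank3 unfolding matroid_rank_def by metis
  have "\<not> B \<subseteq> {e, e'}" using B(3) e(3) card_mono[of "{e, e'}" B] by auto
  then obtain x where x: "x \<in> B" "x \<noteq> e" "x \<noteq> e'" by blast
  have i: "{e, x} \<in> indep M" by (rule M.indep_subset[OF B(1)]) (use B x in auto)
  have "{e, e', x} \<in> indep M" by (rule M.indep_subset[OF B(1)]) (use B x in auto)
  then have "e' \<notin> M.cl {e, x}" using M.cl_indep(1)[OF i] e x by (auto simp: insert_commute)
  moreover have "M.cl {e, x} \<in> H"
    using M.cl_indep(2)[OF i] M.cl_flat[OF M.indep_ground[OF i]] x by (simp add: rank_flats_def)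
  moreover have "e \<in> M.cl {e, x}" using M.cl_superset[of "{e, x}"] by simp
  ultimately show ?thesis by (auto simp: star_def)
qed

lemma star_inj: "e \<in> ground M \<Longrightarrow> e' \<in> ground M \<Longrightarrow> star e = star e' \<Longrightarrow> e = e'"
  using star_separates[of e e'] by (auto simp: star_def)

text \<open>A star has rank 2 in a matroid of rank 3, so it is a hyperplane.\<close>

lemma star_maximal:
  assumes "e \<in> ground M" "P \<in> flats W" "P \<noteq> H" "star e \<subseteq> P"
  shows "star e = P"
proof -
  have "rk W P < 3" using W.rk_proper_flat[of P] assms rank_W ground_W by simp
  then show ?thesis
    using W.flat_eqI[of "star e" P] W.rk_mono[of "star e" P] star_flat assms by simp
qed

section \<open>Finite vectors in the tropical linear space of the adjoint\<close>

definition weight :: "('a set \<Rightarrow> real) \<Rightarrow> bool" where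
  "weight w \<longleftrightarrow> (\<forall>c. {F \<in> H. c \<le> w F} \<in> flats W)"

lemma weight_min: "weight w \<Longrightarrow> weight w' \<Longrightarrow> weight (\<lambda>F. min (w F) (w' F))"
proof -
  have "{F \<in> H. c \<le> min (w F) (w' F)} = {F \<in> H. c \<le> w F} \<inter> {F \<in> H. c \<le> w' F}" for c by auto
  then show "weight w \<Longrightarrow> weight w' \<Longrightarrow> weight (\<lambda>F. min (w F) (w' F))"
    using W.flat_Int by (simp add: weight_def)
qed

lemma weight_add: "weight w \<Longrightarrow> weight (\<lambda>F. w F + a)"
  by (simp add: weight_def flip: diff_le_eq)

lemma weight_flag:
  assumes "P \<in> flats W" "F \<in> P" "0 \<le> a" "a \<le> b"
  shows "weight (\<lambda>X. if X = F then b else if X \<in> P then a else 0)"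
  unfolding weight_def
proof
  fix c
  have PH: "P \<subseteq> H" using W.flat_subset assms ground_W by blast
  have "{X \<in> H. c \<le> (if X = F then b else if X \<in> P then a else 0)} =
     (if c \<le> 0 then H else if c \<le> a then P else if c \<le> b then {F} else {})"
    using assms PH by auto
  then show "{X \<in> H. c \<le> (if X = F then b else if X \<in> P then a else 0)} \<in> flats W"
    using assms PH W.ground_flat ground_W singleton_flat empty_flat by auto
qed

text \<open>By finiteness of \<open>H\<close>, a nonempty strict superlevel set is the superlevel
  set at the next value. For \<open>c = low w\<close> this yields the flats of the local
  matroid.\<close>

lemma weight_strict:
  assumes w: "weight w"
  shows "{F \<in> H. c < w F} \<in> flats W"
proof (cases "{F \<in> H. c < w F} = {}")
  case True
  show ?thesis unfolding True by (rule empty_flat)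
next
  case False
  define c' where "c' = Min (w ` {F \<in> H. c < w F})"
  have "c' \<in> w ` {F \<in> H. c < w F}" unfolding c'_def using finite_H False by (intro Min_in) auto
  moreover have "c' \<le> w F" if "F \<in> H" "c < w F" for F
    unfolding c'_def using finite_H that by (intro Min_le) auto
  ultimately have "{F \<in> H. c < w F} = {F \<in> H. c' \<le> w F}" by fastforce
  then show ?thesis using w by (simp add: weight_def)
qed

definition low :: "('a set \<Rightarrow> real) \<Rightarrow> real" where
  "low w = Min (w ` H)"

definition alow :: "('a set \<Rightarrow> real) \<Rightarrow> 'a \<Rightarrow> real" where
  "alow w e = Min (w ` star e)"

lemma low_le: "F \<in> H \<Longrightarrow> low w \<le> w F"
  unfolding low_def using finite_H by (intro Min_le) auto

lemma low_attained: "\<exists>F\<in>H. w F = low w"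
proof -
  have "low w \<in> w ` H" unfolding low_def using finite_H H_nonempty by (intro Min_in) auto
  then show ?thesis by auto
qed

lemma alow_le: "F \<in> H \<Longrightarrow> e \<in> F \<Longrightarrow> alow w e \<le> w F"
  unfolding alow_def using finite_star by (intro Min_le) (auto simp: star_def)

lemma alow_attained: "e \<in> ground M \<Longrightarrow> \<exists>F\<in>H. e \<in> F \<and> w F = alow w e"
proof -
  assume "e \<in> ground M"
  then have "alow w e \<in> w ` star e" unfolding alow_def using finite_star star_nonempty by (intro Min_in) auto
  then show ?thesis by (auto simp: star_def)
qed

lemma low_le_alow: "e \<in> ground M \<Longrightarrow> low w \<le> alow w e"
  using alow_attained low_le by metis

lemma low_eqI: "F \<in> H \<Longrightarrow> w F = c \<Longrightarrow> (\<And>X. X \<in> H \<Longrightarrow> c \<le> w X) \<Longrightarrow> low w = c"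
  unfolding low_def using finite_H by (intro Min_eqI) auto

lemma alow_eqI:
  "F \<in> H \<Longrightarrow> e \<in> F \<Longrightarrow> w F = c \<Longrightarrow> (\<And>X. X \<in> H \<Longrightarrow> e \<in> X \<Longrightarrow> c \<le> w X) \<Longrightarrow> alow w e = c"
  unfolding alow_def using finite_star by (intro Min_eqI) (auto simp: star_def)

text \<open>If every two lines meet, \<open>gap F p\<close> is the distance from \<open>p\<close> to
  the closed star of \<open>F\<close>; disjoint lines are treated as if they met. Unit edge lengths
  make the pieces fit together at the vertices.\<close>

fun gap :: "'a set \<Rightarrow> ('a + 'a set, 'a \<times> 'a set) point \<Rightarrow> real" where
  "gap F (Vertex (Inl e)) = (if e \<in> F then 0 else 2)"
| "gap F (Vertex (Inr X)) = (if F = X then 0 else 1)"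
| "gap F (Interior (e, X) t) = (if F = X then 0 else if e \<in> F then t else 2 - t)"

definition phi :: "('a set \<Rightarrow> real) \<Rightarrow> ('a + 'a set, 'a \<times> 'a set) point \<Rightarrow> real" where
  "phi w = (\<lambda>p\<in>points G. Min ((\<lambda>F. w F + gap F p) ` H))"

lemma edges_G: "(e, F) \<in> edges G \<longleftrightarrow> F \<in> H \<and> e \<in> F"
  by (auto simp: levi_graph_def)

lemma len_G: "F \<in> H \<Longrightarrow> e \<in> F \<Longrightarrow> len G (e, F) = 1"
  by (simp add: levi_graph_def len)

lemma point_cases:
  assumes "p \<in> points G"
  obtains (elem) e where "e \<in> ground M" "p = Vertex (Inl e)"
  | (line) F where "F \<in> H" "p = Vertex (Inr F)"
  | (inner) e F t where "F \<in> H" "e \<in> F" "0 < t" "t < 1" "p = Interior (e, F) t"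
  using assms len by (fastforce simp: points_def levi_graph_def)

lemma points_G:
  "Vertex (Inl e) \<in> points G \<longleftrightarrow> e \<in> ground M"
  "Vertex (Inr F) \<in> points G \<longleftrightarrow> F \<in> H"
  "F \<in> H \<Longrightarrow> e \<in> F \<Longrightarrow> Interior (e, F) t \<in> points G \<longleftrightarrow> 0 < t \<and> t < 1"
  by (auto simp: points_def levi_graph_def len)

lemma edge_point_G:
  assumes "F \<in> H" "e \<in> F"
  shows "edge_point G (e, F) t =
    (if t = 0 then Vertex (Inl e) else if t = 1 then Vertex (Inr F) else Interior (e, F) t)"
  using assms by (simp add: edge_point_def levi_graph_def len)

lemma edge_point_in_points:
  assumes "F \<in> H" "e \<in> F" "0 \<le> t" "t \<le> 1"
  shows "edge_point G (e, F) t \<in> points G"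
  using assms H_subset by (auto simp: edge_point_G points_G)

text \<open>The three branches come from \<open>F\<close> itself, the other lines through
  \<open>e\<close>, and the lines missing \<open>e\<close>. Taking the minima
  \<open>alow w e\<close> and \<open>low w\<close> over larger sets does no harm: the extra lines
  give values no smaller than another branch.\<close>

lemma phi_edge:
  assumes F: "F \<in> H" "e \<in> F" and t: "0 \<le> t" "t \<le> 1"
  shows "phi w (edge_point G (e, F) t) = min (w F) (min (alow w e + t) (low w + 2 - t))"
proof -
  let ?v = "min (w F) (min (alow w e + t) (low w + 2 - t))"
  have gap: "gap X (edge_point G (e, F) t) = (if X = F then 0 else if e \<in> X then t else 2 - t)" for X
    using F by (auto simp: edge_point_G)
  have e: "e \<in> ground M" using F H_subset by blast
  have "Min ((\<lambda>X. w X + gap X (edge_point G (e, F) t)) ` H) = ?v"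
  proof (rule Min_eqI)
    fix y assume "y \<in> (\<lambda>X. w X + gap X (edge_point G (e, F) t)) ` H"
    then obtain X where X: "X \<in> H" "y = w X + (if X = F then 0 else if e \<in> X then t else 2 - t)"
      by (auto simp: gap)
    then show "?v \<le> y" using alow_le[of X e w] low_le[of X w] by auto
  next
    obtain X where X: "X \<in> H" "e \<in> X" "w X = alow w e" using alow_attained[OF e] by blast
    obtain Y where Y: "Y \<in> H" "w Y = low w" using low_attained by blast
    consider "?v = w F" | "w F > alow w e + t" "?v = alow w e + t"
      | "w F > low w + 2 - t" "alow w e + t > low w + 2 - t" "?v = low w + 2 - t"
      by linarith
    then have "\<exists>X\<in>H. ?v = w X + (if X = F then 0 else if e \<in> X then t else 2 - t)"
    proof cases
      case 1
      then show ?thesis using F by (intro bexI[of _ F]) auto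
    next
      case 2
      then show ?thesis using X t by (intro bexI[of _ X]) auto
    next
      case 3
      have "Y \<noteq> F" using 3 Y t by auto
      moreover have "e \<notin> Y" using 3 Y t alow_le[of Y e w] by auto
      ultimately show ?thesis using 3 Y by (intro bexI[of _ Y]) auto
    qed
    then show "?v \<in> (\<lambda>X. w X + gap X (edge_point G (e, F) t)) ` H" by (auto simp: gap)
  qed (use finite_H in simp)
  then show ?thesis using edge_point_in_points[OF F t] by (simp add: phi_def)
qed

lemma phi_line:
  assumes F: "F \<in> H"
  shows "phi w (Vertex (Inr F)) = min (w F) (low w + 1)"
proof -
  obtain e where e: "e \<in> F" using line_card[OF F] by fastforce
  then have "low w \<le> alow w e" using F H_subset low_le_alow by blast
  then show ?thesis using phi_edge[OF F e, of 1 w] F e by (simp add: edge_point_G)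
qed

lemma phi_PL: "phi w \<in> PL G"
  unfolding PL_def
proof (intro CollectI conjI ballI)
  fix x assume "x \<in> edges G"
  then obtain e F where x: "x = (e, F)" "F \<in> H" "e \<in> F" by (cases x) (auto simp: edges_G)
  show "pl_on (len G x) (\<lambda>t. phi w (edge_point G x t))"
    unfolding x(1) by (rule pl_on_min3) (use phi_edge x len_G in auto)
qed (simp add: phi_def)

section \<open>Divisors\<close>

abbreviation left_min3 :: "real \<Rightarrow> real \<Rightarrow> real \<Rightarrow> int" where
  "left_min3 x y z \<equiv> (if y \<le> x \<and> y \<le> z then 1 else if x \<le> z then 0 else -1)"

abbreviation right_min3 :: "real \<Rightarrow> real \<Rightarrow> real \<Rightarrow> int" where
  "right_min3 x y z \<equiv> (if z \<le> x \<and> z \<le> y then -1 else if x \<le> y then 0 else 1)"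

lemma left_slope_phi:
  assumes "F \<in> H" "e \<in> F" "0 < t" "t \<le> 1"
  shows "left_slope (\<lambda>u. phi w (edge_point G (e, F) u)) t =
    left_min3 (w F) (alow w e + t) (low w + 2 - t)"
  by (rule left_slope_min3[of t]) (use assms phi_edge in auto)

lemma right_slope_phi:
  assumes "F \<in> H" "e \<in> F" "0 \<le> t" "t < 1"
  shows "right_slope (\<lambda>u. phi w (edge_point G (e, F) u)) t =
    right_min3 (w F) (alow w e + t) (low w + 2 - t)"
  by (rule right_slope_min3[of "1 - t"]) (use assms phi_edge in auto)

lemma divis_inner:
  assumes "F \<in> H" "e \<in> F" "0 < t" "t < 1"
  shows "divis G (phi w) (Interior (e, F) t) =
    left_min3 (w F) (alow w e + t) (low w + 2 - t) - right_min3 (w F) (alow w e + t) (low w + 2 - t)"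
  using assms by (simp add: divis_def points_G left_slope_phi right_slope_phi del: if_splits)

lemma tail_head_G [simp]: "tail G x \<noteq> Inr F" "head G x \<noteq> Inl e"
  by (simp_all add: levi_graph_def split: prod.splits)

text \<open>Edges point from elements to lines, so a line vertex sees only left slopes at parameter
  1, and an element vertex only right slopes at 0.\<close>

lemma divis_line:
  assumes F: "F \<in> H"
  shows "divis G (phi w) (Vertex (Inr F)) = (\<Sum>e\<in>F. left_min3 (w F) (alow w e + 1) (low w + 1))"
proof -
  have "{x \<in> edges G. head G x = Inr F} = (\<lambda>e. (e, F)) ` F"
    using F by (auto simp: levi_graph_def)
  moreover have "inj_on (\<lambda>e. (e, F)) F" by (auto intro: inj_onI)
  ultimately have "divis G (phi w) (Vertex (Inr F)) =
      (\<Sum>e\<in>F. left_slope (\<lambda>t. phi w (edge_point G (e, F) t)) (len G (e, F)))"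
    using F by (simp add: divis_def points_G sum.reindex)
  also have "\<dots> = (\<Sum>e\<in>F. left_min3 (w F) (alow w e + 1) (low w + 1))"
    by (rule sum.cong) (use F in \<open>simp_all add: len_G left_slope_phi\<close>)
  finally show ?thesis .
qed

lemma divis_elem:
  assumes e: "e \<in> ground M"
  shows "divis G (phi w) (Vertex (Inl e)) = - (\<Sum>F\<in>star e. right_min3 (w F) (alow w e) (low w + 2))"
proof -
  have "{x \<in> edges G. tail G x = Inl e} = (\<lambda>F. (e, F)) ` star e"
    by (auto simp: levi_graph_def star_def)
  moreover have "inj_on (\<lambda>F. (e, F)) (star e)" by (auto intro: inj_onI)
  ultimately have "divis G (phi w) (Vertex (Inl e)) =
      - (\<Sum>F\<in>star e. right_slope (\<lambda>t. phi w (edge_point G (e, F) t)) 0)"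
    using e by (simp add: divis_def points_G sum.reindex)
  also have "\<dots> = - (\<Sum>F\<in>star e. right_min3 (w F) (alow w e) (low w + 2))"
    by (intro arg_cong[where f = uminus] sum.cong) (auto simp: star_def right_slope_phi)
  finally show ?thesis .
qed

lemma D_simps [simp]:
  "e \<in> ground M \<Longrightarrow> D (Vertex (Inl e)) = 1"
  "D (Vertex (Inr F)) = 0"
  "D (Interior x t) = 0"
  by (auto simp: cartwright_divisor_def)

definition chips :: "('a set \<Rightarrow> real) \<Rightarrow> ('a + 'a set, 'a \<times> 'a set) point \<Rightarrow> int" where
  "chips w p = D p + divis G (phi w) p"

text \<open>A minimum of affine functions is concave, so the slope never increases. It drops by at
  least 1 where two branches tie at the minimum, and from 1 to -1 where all three do.\<close>

lemma chips_inner: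
  assumes "F \<in> H" "e \<in> F" "0 < t" "t < 1"
  shows "0 \<le> chips w (Interior (e, F) t)"
    and "w F = alow w e + t \<and> alow w e + t \<le> low w + 2 - t \<or>
      w F = low w + 2 - t \<and> low w + 2 - t \<le> alow w e + t \<or>
      alow w e + t = low w + 2 - t \<and> alow w e + t \<le> w F \<Longrightarrow> 1 \<le> chips w (Interior (e, F) t)"
    and "w F = alow w e + t \<Longrightarrow> w F = low w + 2 - t \<Longrightarrow> 2 \<le> chips w (Interior (e, F) t)"
  unfolding chips_def divis_inner[OF assms] by (auto split: if_splits)

text \<open>If all lines through \<open>e\<close> have weight above the minimum,
  \<open>star e\<close> lies in the proper flat of such lines and hence equals it; distinct elements
  have distinct stars.\<close>

lemma high_elements:
  assumes w: "weight w" and F: "F \<in> H"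
  shows "card {e \<in> F. low w < alow w e} \<le> 1"
proof -
  define P where "P = {X \<in> H. low w < w X}"
  have P: "P \<in> flats W" unfolding P_def by (rule weight_strict[OF w])
  have PH: "P \<noteq> H" using low_attained[of w] by (force simp: P_def)
  have "star e = P" if "e \<in> F" "low w < alow w e" for e
  proof (rule star_maximal[OF _ P PH])
    show "star e \<subseteq> P" using alow_le[of _ e w] that by (force simp: star_def P_def)
  qed (use that F H_subset in blast)
  then have "e = e'" if "e \<in> {e \<in> F. low w < alow w e}" "e' \<in> {e \<in> F. low w < alow w e}" for e e'
    using that F H_subset star_inj[of e e'] by auto
  then show ?thesis
    using finite_line[OF F] by (simp add: card_le_Suc0_iff_eq)
qed

text \<open>Below \<open>low w + 1\<close> all slopes into \<open>F\<close> vanish. From there on an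
  element with \<open>alow w e = low w\<close> contributes 1, and the at most one other element
  contributes -1 at worst, or 0 if \<open>w F = low w + 1\<close>. A line has at least two
  elements.\<close>

lemma chips_line:
  assumes w: "weight w" and F: "F \<in> H"
  shows "0 \<le> chips w (Vertex (Inr F))"
    and "w F = low w + 1 \<Longrightarrow> 1 \<le> chips w (Vertex (Inr F))"
    and "0 < chips w (Vertex (Inr F)) \<Longrightarrow> low w < w F"
proof -
  let ?X = "{e \<in> F. low w < alow w e}"
  have c: "chips w (Vertex (Inr F)) = (\<Sum>e\<in>F. left_min3 (w F) (alow w e + 1) (low w + 1))"
    by (simp add: chips_def divis_line[OF F])
  have fin: "finite F" by (rule finite_line[OF F])
  have la: "low w \<le> alow w e" if "e \<in> F" for e using that F H_subset low_le_alow by blast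
  have small: "chips w (Vertex (Inr F)) = 0" if "w F < low w + 1"
    unfolding c using that la by (intro sum.neutral) force
  have split: "(\<Sum>e\<in>F. if e \<in> ?X then d else 1) = int (card (F - ?X)) + d * int (card ?X)" for d
  proof -
    have "(\<Sum>e\<in>F. if e \<in> ?X then d else 1) = (\<Sum>e\<in>F - ?X. if e \<in> ?X then d else 1)
        + (\<Sum>e\<in>?X. if e \<in> ?X then d else 1)"
      using fin by (intro sum.subset_diff) auto
    then show ?thesis by (simp add: sum.If_cases fin)
  qed
  have "int (card (F - ?X)) = int (card F) - int (card ?X)"
    using fin card_mono[of F ?X] by (subst card_Diff_subset) (auto simp: of_nat_diff)
  then have cards: "int (card (F - ?X)) \<ge> 1" "int (card (F - ?X)) \<ge> int (card ?X)"
    using line_card[OF F] high_elements[OF w F] by linarith+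
  have big: "int (card (F - ?X)) - int (card ?X) \<le> chips w (Vertex (Inr F))" if "low w + 1 \<le> w F"
  proof -
    have "(\<Sum>e\<in>F. if e \<in> ?X then - 1 else 1) \<le> chips w (Vertex (Inr F))"
      unfolding c using that la by (intro sum_mono) force
    then show ?thesis using split[of "-1"] by simp
  qed
  show "0 \<le> chips w (Vertex (Inr F))" using small big cards by linarith
  show "1 \<le> chips w (Vertex (Inr F))" if "w F = low w + 1"
  proof -
    have "(\<Sum>e\<in>F. if e \<in> ?X then 0 else 1) \<le> chips w (Vertex (Inr F))"
      unfolding c using that la by (intro sum_mono) force
    then show ?thesis using split[of 0] cards by simp
  qed
  show "low w < w F" if "0 < chips w (Vertex (Inr F))"
    using small that by linarith
qed

lemma chips_line_two:
  assumes F: "F \<in> H" and wF: "w F = low w + 1" and low: "\<And>e. e \<in> F \<Longrightarrow> alow w e = low w"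
  shows "2 \<le> chips w (Vertex (Inr F))"
proof -
  have "chips w (Vertex (Inr F)) = (\<Sum>e\<in>F. 1)"
    unfolding chips_def divis_line[OF F] D_simps using wF low by simp
  then show ?thesis using line_card[OF F] by simp
qed

text \<open>An edge leaves \<open>e\<close> with slope 1 only if the weight of its line exceeds
  \<open>alow w e\<close>. Such lines form a flat properly inside the rank 2 flat
  \<open>star e\<close>, so there is at most one, and the chip of \<open>D\<close> at
  \<open>e\<close> pays for it.\<close>

lemma chips_elem:
  assumes e: "e \<in> ground M"
  shows "weight w \<Longrightarrow> 0 \<le> chips w (Vertex (Inl e))"
    and "(\<And>F. F \<in> H \<Longrightarrow> e \<in> F \<Longrightarrow> w F \<le> alow w e) \<Longrightarrow> 1 \<le> chips w (Vertex (Inl e))"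
    and "low w + 2 \<le> alow w e \<Longrightarrow> 2 \<le> chips w (Vertex (Inl e))"
proof -
  have c: "chips w (Vertex (Inl e)) = 1 - (\<Sum>F\<in>star e. right_min3 (w F) (alow w e) (low w + 2))"
    by (simp add: chips_def divis_elem[OF e] e)
  show two: "2 \<le> chips w (Vertex (Inl e))" if "low w + 2 \<le> alow w e"
  proof -
    have "right_min3 (w F) (alow w e) (low w + 2) = -1" if "F \<in> star e" for F
      using that \<open>low w + 2 \<le> alow w e\<close> alow_le[of F e w] by (simp add: star_def)
    then have "(\<Sum>F\<in>star e. right_min3 (w F) (alow w e) (low w + 2)) = (\<Sum>F\<in>star e. - 1)"
      by (intro sum.cong) auto
    then show ?thesis using star_card[OF e] by (simp add: c)
  qed
  show "1 \<le> chips w (Vertex (Inl e))" if "\<And>F. F \<in> H \<Longrightarrow> e \<in> F \<Longrightarrow> w F \<le> alow w e"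
  proof -
    have "(\<Sum>F\<in>star e. right_min3 (w F) (alow w e) (low w + 2)) \<le> 0"
      by (rule sum_nonpos) (use that in \<open>auto simp: star_def\<close>)
    then show ?thesis by (simp add: c)
  qed
  show "0 \<le> chips w (Vertex (Inl e))" if w: "weight w"
  proof -
    define Y where "Y = star e \<inter> {F \<in> H. alow w e < w F}"
    have Y: "Y \<in> flats W" unfolding Y_def using W.flat_Int[OF star_flat(1)[OF e] weight_strict[OF w]] .
    have fY: "finite Y" using finite_star by (simp add: Y_def)
    have Ys: "Y \<subseteq> star e" by (simp add: Y_def)
    obtain F where "F \<in> H" "e \<in> F" "w F = alow w e" using alow_attained[OF e] by blast
    then have "F \<in> star e" "F \<notin> Y" by (auto simp: Y_def star_def)
    then have "rk W Y \<noteq> rk W (star e)" using W.flat_eqI[OF Y star_flat(1)[OF e] Ys] by blast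
    then have rk: "rk W Y < 2" using W.rk_mono[OF Ys] star_flat(2)[OF e] by simp
    have "F1 = F2" if "F1 \<in> Y" "F2 \<in> Y" for F1 F2
    proof (rule ccontr)
      assume "F1 \<noteq> F2"
      moreover have "{F1, F2} \<in> indep W" using that by (intro indep_two_lines) (auto simp: Y_def)
      then have "card {F1, F2} \<le> rk W Y" by (rule W.card_le_rk) (use that in simp)
      ultimately show False using rk by simp
    qed
    then have card: "card Y \<le> 1" using fY by (simp add: card_le_Suc0_iff_eq)
    have "(\<Sum>F\<in>star e. right_min3 (w F) (alow w e) (low w + 2)) \<le> (\<Sum>F\<in>star e. if F \<in> Y then 1 else 0)"
      by (rule sum_mono) (auto simp: Y_def star_def)
    also have "\<dots> = int (card Y)"
      using finite_star Ys by (simp add: sum.If_cases Int_absorb1)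
    finally show ?thesis using card by (simp add: c)
  qed
qed

lemma chips_outside: "p \<notin> points G \<Longrightarrow> chips w p = 0"
  by (auto simp: chips_def divis_def cartwright_divisor_def points_G)

lemma chips_nonneg:
  assumes "weight w"
  shows "0 \<le> chips w p"
proof (cases "p \<in> points G")
  case True
  then show ?thesis
    by (cases rule: point_cases) (use assms chips_inner(1) chips_line(1) chips_elem(1) in auto)
qed (simp add: chips_outside)

lemma phi_RD: "weight w \<Longrightarrow> phi w \<in> RD G D"
  using chips_nonneg phi_PL by (simp add: RD_def effective_def chips_def)

section \<open>The linear series\<close>

definition series :: "(('a + 'a set, 'a \<times> 'a set) point \<Rightarrow> real) set" where
  "series = phi ` {w. weight w}"

lemma phi_le: "p \<in> points G \<Longrightarrow> F \<in> H \<Longrightarrow> phi w p \<le> w F + gap F p"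
  unfolding phi_def using finite_H by (simp add: Min_le)

lemma phi_attained: "p \<in> points G \<Longrightarrow> \<exists>F\<in>H. phi w p = w F + gap F p"
proof -
  assume p: "p \<in> points G"
  have "Min ((\<lambda>F. w F + gap F p) ` H) \<in> (\<lambda>F. w F + gap F p) ` H"
    using finite_H H_nonempty by (intro Min_in) auto
  then show ?thesis using p by (auto simp: phi_def)
qed

lemma gap_bounds: "p \<in> points G \<Longrightarrow> 0 \<le> gap F p \<and> gap F p \<le> 2"
  by (erule point_cases) auto

lemma phi_min: "phi (\<lambda>F. min (w F) (w' F)) = tmin (points G) (phi w) (phi w')"
proof
  fix p
  show "phi (\<lambda>F. min (w F) (w' F)) p = tmin (points G) (phi w) (phi w') p"
  proof (cases "p \<in> points G")
    case p: True
    obtain F F1 F2 where F: "F \<in> H" "phi (\<lambda>F. min (w F) (w' F)) p = min (w F) (w' F) + gap F p"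
      "F1 \<in> H" "phi w p = w F1 + gap F1 p" "F2 \<in> H" "phi w' p = w' F2 + gap F2 p"
      using phi_attained[OF p, of w] phi_attained[OF p, of w']
        phi_attained[OF p, of "\<lambda>F. min (w F) (w' F)"] by blast
    have "phi w p \<le> w F + gap F p" "phi w' p \<le> w' F + gap F p"
      "phi (\<lambda>F. min (w F) (w' F)) p \<le> min (w F1) (w' F1) + gap F1 p"
      "phi (\<lambda>F. min (w F) (w' F)) p \<le> min (w F2) (w' F2) + gap F2 p"
      using phi_le[OF p] F(1,3,5) by auto
    then show ?thesis using p F(2,4,6) by (auto simp: tmin_def min_def split: if_splits)
  qed (simp add: phi_def tmin_def)
qed

lemma phi_add: "phi (\<lambda>F. w F + a) = tscale (points G) a (phi w)"
proof
  fix p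
  show "phi (\<lambda>F. w F + a) p = tscale (points G) a (phi w) p"
  proof (cases "p \<in> points G")
    case p: True
    obtain F F1 where F: "F \<in> H" "phi (\<lambda>F. w F + a) p = w F + a + gap F p"
      "F1 \<in> H" "phi w p = w F1 + gap F1 p"
      using phi_attained[OF p, of w] phi_attained[OF p, of "\<lambda>F. w F + a"] by auto
    then show ?thesis
      using p phi_le[OF p F(1), of w] phi_le[OF p F(3), of "\<lambda>F. w F + a"] by (simp add: tscale_def)
  qed (simp add: phi_def tscale_def)
qed

lemma series_tmin: "\<phi> \<in> series \<Longrightarrow> \<psi> \<in> series \<Longrightarrow> tmin (points G) \<phi> \<psi> \<in> series"
  by (auto simp: series_def intro!: weight_min simp flip: phi_min)

lemma series_tscale: "\<phi> \<in> series \<Longrightarrow> tscale (points G) a \<phi> \<in> series"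
  by (auto simp: series_def intro!: weight_add simp flip: phi_add)

lemma series_submodule: "tropical_submodule G D series"
  using phi_RD series_tmin series_tscale by (auto simp: tropical_submodule_def series_def)

lemma weight_indicator:
  assumes "P \<in> flats W" "0 \<le> a"
  shows "weight (\<lambda>X. if X \<in> P then a else 0)"
proof (cases "P = {}")
  case True
  have "{F \<in> H. c \<le> 0} \<in> flats W" for c :: real
    using W.ground_flat ground_W empty_flat by (cases "c \<le> 0") auto
  then show ?thesis by (simp add: weight_def True)
next
  case False
  then obtain F where F: "F \<in> P" by blast
  have "(\<lambda>X. if X \<in> P then a else 0) = (\<lambda>X. if X = F then a else if X \<in> P then a else 0)"
    using F by auto
  then show ?thesis using weight_flag[OF assms(1) F assms(2), of a] by simp
qed

lemma series_finite_min:
  assumes "finite T" "T \<noteq> {}" "T \<subseteq> series"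
  shows "(\<lambda>p\<in>points G. Min ((\<lambda>\<phi>. \<phi> p + a \<phi>) ` T)) \<in> series"
  using assms
proof (induction rule: finite_ne_induct)
  case (singleton \<phi>)
  then have "tscale (points G) (a \<phi>) \<phi> \<in> series"
    by (intro series_tscale) simp
  moreover have "tscale (points G) (a \<phi>) \<phi> = (\<lambda>p\<in>points G. Min ((\<lambda>\<phi>. \<phi> p + a \<phi>) ` {\<phi>}))"
    by (auto simp: tscale_def)
  ultimately show ?case by (simp only:)
next
  case (insert \<phi> T)
  then have "tmin (points G) (tscale (points G) (a \<phi>) \<phi>) (\<lambda>p\<in>points G. Min ((\<lambda>\<phi>. \<phi> p + a \<phi>) ` T)) \<in> series"
    by (intro series_tmin series_tscale insert.IH) auto
  moreover have "tmin (points G) (tscale (points G) (a \<phi>) \<phi>) (\<lambda>p\<in>points G. Min ((\<lambda>\<phi>. \<phi> p + a \<phi>) ` T))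
      = (\<lambda>p\<in>points G. Min ((\<lambda>\<phi>. \<phi> p + a \<phi>) ` insert \<phi> T))"
    using insert by (auto simp: tmin_def tscale_def)
  ultimately show ?case by (simp only:)
qed

text \<open>The gaps lie between \<open>0\<close> and \<open>2\<close>, so entries above \<open>low w + 2\<close> do not matter.\<close>

lemma phi_truncate: "phi (\<lambda>F. min (w F) (low w + 2)) = phi w"
proof
  fix p
  show "phi (\<lambda>F. min (w F) (low w + 2)) p = phi w p"
  proof (cases "p \<in> points G")
    case p: True
    obtain F where F: "F \<in> H" "phi (\<lambda>F. min (w F) (low w + 2)) p = min (w F) (low w + 2) + gap F p"
      using phi_attained[OF p] by blast
    obtain F1 where F1: "F1 \<in> H" "phi w p = w F1 + gap F1 p" using phi_attained[OF p] by blast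
    obtain F0 where F0: "F0 \<in> H" "w F0 = low w" using low_attained by blast
    have "phi w p \<le> w F + gap F p" "phi w p \<le> w F0 + gap F0 p"
      "phi (\<lambda>F. min (w F) (low w + 2)) p \<le> min (w F1) (low w + 2) + gap F1 p"
      by (rule phi_le[OF p F(1)], rule phi_le[OF p F0(1)], rule phi_le[OF p F1(1)])
    then show ?thesis using F F1 F0 gap_bounds[OF p, of F0] gap_bounds[OF p, of F] by auto
  qed (simp add: phi_def)
qed

lemma weight_const: "weight (\<lambda>_. a)"
proof -
  have "{F \<in> H. c \<le> a} \<in> flats W" for c
    using W.ground_flat ground_W empty_flat by (cases "c \<le> a") auto
  then show ?thesis by (simp add: weight_def)
qed

text \<open>The generators belong to proper flats, with weight 2 on the flat and 0 elsewhere. A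
  weight truncated to spread at most 2 is recovered as the minimum, over the lines \<open>F\<close>,
  of \<open>w F\<close> plus the generator of the flat of lines heavier than
  \<open>F\<close>.\<close>

lemma series_finitely_generated: "finitely_generated G series"
proof -
  define \<beta> where "\<beta> P = phi (\<lambda>X. if X \<in> P then 2 else 0)" for P
  define B where "B = \<beta> ` {P \<in> flats W. P \<noteq> H}"
  have "finite (flats W)"
    by (rule finite_subset[of _ "Pow H"]) (use W.flat_subset ground_W finite_H in auto)
  then have finB: "finite B" by (simp add: B_def)
  have "B \<subseteq> series" using weight_indicator by (auto simp: B_def \<beta>_def series_def)
  have \<beta>_line: "\<beta> P (Vertex (Inr F)) = 0 \<longleftrightarrow> F \<notin> P" if F: "F \<in> H" and P: "P \<in> flats W" "P \<noteq> H" for P F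
  proof -
    obtain F0 where F0: "F0 \<in> H" "F0 \<notin> P" using P W.flat_subset ground_W by blast
    then have "low (\<lambda>X. if X \<in> P then 2 else 0) = 0" by (intro low_eqI[OF F0(1)]) auto
    then show ?thesis using phi_line[OF F] by (simp add: \<beta>_def)
  qed
  show ?thesis
    unfolding finitely_generated_def
  proof (intro exI[of _ B] conjI set_eqI iffI)
    fix \<phi> assume "\<phi> \<in> {\<lambda>p\<in>points G. Min ((\<lambda>\<phi>. \<phi> p + a \<phi>) ` T) |T a. T \<subseteq> B \<and> T \<noteq> {}}"
    then obtain T a where T: "T \<subseteq> B" "T \<noteq> {}" "\<phi> = (\<lambda>p\<in>points G. Min ((\<lambda>\<phi>. \<phi> p + a \<phi>) ` T))" by blast
    then show "\<phi> \<in> series"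
      using series_finite_min[of T a] finB \<open>B \<subseteq> series\<close> by (meson finite_subset order_trans)
  next
    fix \<phi> assume "\<phi> \<in> series"
    then obtain w0 where w0: "weight w0" "\<phi> = phi w0" by (auto simp: series_def)
    define w where "w F = min (w0 F) (low w0 + 2)" for F
    have w: "weight w" unfolding w_def using weight_min[OF w0(1) weight_const] .
    have \<phi>: "\<phi> = phi w" using w0 phi_truncate[of w0] by (simp add: w_def[abs_def])
    have range: "w F \<le> w F' + 2" if "F' \<in> H" for F F'
      using low_le[OF that, of w0] by (auto simp: w_def)
    define P where "P F = {X \<in> H. w F < w X}" for F
    have P: "P F \<in> flats W" for F unfolding P_def by (rule weight_strict[OF w])
    have PH: "P F \<noteq> H" if "F \<in> H" for F using that by (auto simp: P_def)
    \<comment> \<open>Shifts are attached to functions, not to lines, so a line has to be chosen. By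
      \<open>\<beta>_line\<close> a generator determines its flat, hence all candidates have the
      same weight.\<close>
    define a where "a \<psi> = w (SOME F. F \<in> H \<and> \<psi> = \<beta> (P F))" for \<psi>
    have a: "a (\<beta> (P F)) = w F" if F: "F \<in> H" for F
    proof -
      define F' where "F' = (SOME F'. F' \<in> H \<and> \<beta> (P F) = \<beta> (P F'))"
      have F': "F' \<in> H" "\<beta> (P F) = \<beta> (P F')"
        using someI[of "\<lambda>F'. F' \<in> H \<and> \<beta> (P F) = \<beta> (P F')" F] F by (simp_all add: F'_def)
      have "F \<notin> P F" "F' \<notin> P F'" by (simp_all add: P_def)
      then have "F \<notin> P F'" "F' \<notin> P F"
        using F'(2) \<beta>_line[OF F P PH[OF F]] \<beta>_line[OF F P PH[OF F'(1)]]
          \<beta>_line[OF F'(1) P PH[OF F]] \<beta>_line[OF F'(1) P PH[OF F'(1)]] by simp_all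
      then show ?thesis using F F' by (simp add: a_def F'_def P_def)
    qed
    have "\<phi> = (\<lambda>p\<in>points G. Min ((\<lambda>\<phi>. \<phi> p + a \<phi>) ` (\<lambda>F. \<beta> (P F)) ` H))"
    proof
      fix p
      show "\<phi> p = (\<lambda>p\<in>points G. Min ((\<lambda>\<phi>. \<phi> p + a \<phi>) ` (\<lambda>F. \<beta> (P F)) ` H)) p"
      proof (cases "p \<in> points G")
        case p: True
        have "Min ((\<lambda>F. \<beta> (P F) p + w F) ` H) = phi w p"
        proof (rule Min_eqI)
          fix y assume "y \<in> (\<lambda>F. \<beta> (P F) p + w F) ` H"
          then obtain F where F: "F \<in> H" "y = \<beta> (P F) p + w F" by blast
          obtain X where X: "X \<in> H" "\<beta> (P F) p = (if X \<in> P F then 2 else 0) + gap X p"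
            using phi_attained[OF p] unfolding \<beta>_def by blast
          have "phi w p \<le> w X + gap X p" by (rule phi_le[OF p X(1)])
          then show "phi w p \<le> y" using F X range[OF F(1), of X] by (auto simp: P_def split: if_splits)
        next
          obtain X where X: "X \<in> H" "phi w p = w X + gap X p" using phi_attained[OF p] by blast
          have "\<beta> (P X) p \<le> (if X \<in> P X then 2 else 0) + gap X p"
            unfolding \<beta>_def by (rule phi_le[OF p X(1)])
          moreover obtain Y where Y: "Y \<in> H" "\<beta> (P X) p = (if Y \<in> P X then 2 else 0) + gap Y p"
            using phi_attained[OF p] unfolding \<beta>_def by blast
          moreover have "phi w p \<le> w Y + gap Y p" by (rule phi_le[OF p Y(1)])
          ultimately have "\<beta> (P X) p + w X = phi w p"
            using X range[OF X(1), of Y] by (auto simp: P_def split: if_splits)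
          then show "phi w p \<in> (\<lambda>F. \<beta> (P F) p + w F) ` H" using X by force
        qed (use finite_H in simp)
        moreover have "(\<lambda>F. \<beta> (P F) p + a (\<beta> (P F))) ` H = (\<lambda>F. \<beta> (P F) p + w F) ` H"
          by (rule image_cong) (use a in auto)
        ultimately show ?thesis using p \<phi> by (simp add: image_image)
      qed (simp add: \<phi> phi_def)
    qed
    moreover have "(\<lambda>F. \<beta> (P F)) ` H \<subseteq> B" using P PH by (auto simp: B_def)
    ultimately show "\<phi> \<in> {\<lambda>p\<in>points G. Min ((\<lambda>\<phi>. \<phi> p + a \<phi>) ` T) |T a. T \<subseteq> B \<and> T \<noteq> {}}"
      using H_nonempty by blast
  qed (rule finB)
qed

section \<open>Minimum loci and the local matroid\<close>

lemma low_le_phi: "p \<in> points G \<Longrightarrow> low w \<le> phi w p"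
  by (metis phi_attained low_le gap_bounds add_increasing2)

lemma min_locus_phi: "min_locus G (phi w) = {p \<in> points G. phi w p = low w}"
proof -
  obtain F where F: "F \<in> H" "w F = low w" using low_attained by blast
  then have "phi w (Vertex (Inr F)) = low w" using phi_line by simp
  moreover have "Vertex (Inr F) \<in> points G" using F by (simp add: points_G)
  ultimately show ?thesis using low_le_phi[of _ w] unfolding min_locus_def by (metis (lifting) order_antisym)
qed

lemma open_star_min_locus:
  assumes F: "F \<in> H"
  shows "open_star G (Inr F) \<subseteq> min_locus G (phi w) \<longleftrightarrow> w F = low w"
proof
  assume "open_star G (Inr F) \<subseteq> min_locus G (phi w)"
  then have "phi w (Vertex (Inr F)) = low w" by (auto simp: open_star_def min_locus_phi)
  then show "w F = low w" using phi_line[OF F, of w] by (simp add: min_def split: if_splits)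
next
  assume wF: "w F = low w"
  show "open_star G (Inr F) \<subseteq> min_locus G (phi w)"
  proof
    fix p assume "p \<in> open_star G (Inr F)"
    then consider "p = Vertex (Inr F)" | e t where "e \<in> F" "0 < t" "t < 1" "p = Interior (e, F) t"
      using F by (auto simp: open_star_def levi_graph_def len)
    then show "p \<in> min_locus G (phi w)"
    proof cases
      case 1
      then show ?thesis using F wF phi_line[OF F, of w] by (simp add: min_locus_phi points_G)
    next
      case 2
      then have "low w \<le> alow w e" using F H_subset low_le_alow by blast
      then have "phi w p = low w"
        using phi_edge[OF F 2(1), of t w] 2 wF F by (simp add: edge_point_G)
      then show ?thesis using 2 F by (simp add: min_locus_phi points_G)
    qed
  qed
qed

text \<open>The flat of \<open>phi w\<close> is the strict superlevel set of \<open>w\<close> at its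
  minimum, and a proper flat arises from its indicator. The whole ground set never arises, since the
  minimum is attained; it is the set added by \<open>insert\<close>.\<close>

lemma series_local_matroid: "is_local_matroid M l series W"
  unfolding is_local_matroid_def
proof (intro conjI)
  have set: "{F \<in> H. \<not> open_star G (Inr F) \<subseteq> min_locus G (phi w)} = {F \<in> H. low w < w F}" for w
    using open_star_min_locus low_le[of _ w] by force
  show "flats W = insert H {{F \<in> H. \<not> open_star G (Inr F) \<subseteq> min_locus G \<phi>} |\<phi>. \<phi> \<in> series}"
  proof (intro set_eqI iffI)
    fix P assume P: "P \<in> flats W"
    show "P \<in> insert H {{F \<in> H. \<not> open_star G (Inr F) \<subseteq> min_locus G \<phi>} |\<phi>. \<phi> \<in> series}"
    proof (cases "P = H")
      case False
      let ?w = "\<lambda>X. if X \<in> P then 1 else 0 :: real"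
      have PH: "P \<subseteq> H" using P W.flat_subset ground_W by blast
      then obtain F0 where F0: "F0 \<in> H" "F0 \<notin> P" using False by blast
      then have "low ?w = 0" by (intro low_eqI[OF F0(1)]) auto
      then have "P = {F \<in> H. low ?w < ?w F}" using PH by auto
      moreover have "phi ?w \<in> series" using weight_indicator[OF P] by (simp add: series_def)
      ultimately show ?thesis using set by blast
    qed simp
  next
    fix P assume "P \<in> insert H {{F \<in> H. \<not> open_star G (Inr F) \<subseteq> min_locus G \<phi>} |\<phi>. \<phi> \<in> series}"
    then consider "P = H" | w where "weight w" "P = {F \<in> H. low w < w F}"
      using set by (auto simp: series_def)
    then show "P \<in> flats W" using weight_strict W.ground_flat ground_W by cases auto
  qed
qed (use W.matroid ground_W in auto)

section \<open>Tropical independence in the series\<close>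

text \<open>The superlevel flat at the smallest entry \<open>u k (i k)\<close> contains all columns except \<open>i k\<close>.\<close>

lemma separated_columns_indep:
  assumes "finite K" and "\<And>k. k \<in> K \<Longrightarrow> weight (u k)" and "\<And>k. k \<in> K \<Longrightarrow> i k \<in> H"
    and "\<And>k l. k \<in> K \<Longrightarrow> l \<in> K \<Longrightarrow> l \<noteq> k \<Longrightarrow> u k (i k) < u l (i k)"
  shows "i ` K \<in> indep W"
  using assms
proof (induction K rule: finite_psubset_induct)
  case (psubset K)
  show ?case
  proof (cases "K = {}")
    case True
    then show ?thesis using W.empty_indep by simp
  next
    case False
    then obtain k where k: "k \<in> K" "\<And>l. l \<in> K \<Longrightarrow> u k (i k) \<le> u l (i l)"
      using finite_attains_min[OF psubset.hyps False, of "\<lambda>k. u k (i k)"] by blast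
    have "i ` (K - {k}) \<in> indep W"
      by (rule psubset.IH) (use k psubset.prems in auto)
    moreover have "u k (i k) < u k (i l)" if "l \<in> K - {k}" for l
      using k(2)[of l] psubset.prems(3)[of l k] that k(1) by auto
    then have "i ` (K - {k}) \<subseteq> {F \<in> H. u k (i k) < u k F}" using psubset.prems(2) by auto
    ultimately have "insert (i k) (i ` (K - {k})) \<in> indep W"
      by (rule W.indep_insert_flat)
        (use weight_strict psubset.prems(1,2) k(1) ground_W in auto)
    moreover have "insert (i k) (i ` (K - {k})) = i ` K" using k by auto
    ultimately show ?thesis by simp
  qed
qed

lemma separated_columns_inj:
  assumes "\<And>k l. k \<in> K \<Longrightarrow> l \<in> K \<Longrightarrow> l \<noteq> k \<Longrightarrow> u k (i k) < (u l (i k) :: real)"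
  shows "inj_on i K"
proof (rule inj_onI)
  fix k l assume "k \<in> K" "l \<in> K" "i k = i l"
  then show "k = l" using assms[of k l] assms[of l k] by fastforce
qed

text \<open>Dependent weights would give dependent functions: if the minimal \<open>\<phi>\<close>
  takes its value at \<open>p\<close> through the line \<open>F\<close>, a row not above it at
  \<open>F\<close> gives a function not above it at \<open>p\<close>. Otherwise the separated
  columns give \<open>card B\<close> independent elements of \<open>W\<close>, whose rank is
  3.\<close>

lemma independent_card_le:
  assumes B: "B \<subseteq> series" "finite B" and ind: "\<not> tropically_dependent G B"
  shows "card B \<le> 3"
proof (rule ccontr)
  assume "\<not> card B \<le> 3"
  then have card: "2 \<le> card B" "4 \<le> card B" by auto
  have "\<forall>\<phi>\<in>B. \<exists>w. weight w \<and> \<phi> = phi w" using B by (auto simp: series_def)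
  then obtain w where w: "\<And>\<phi>. \<phi> \<in> B \<Longrightarrow> weight (w \<phi>)" "\<And>\<phi>. \<phi> \<in> B \<Longrightarrow> \<phi> = phi (w \<phi>)" by metis
  have "\<not> rows_dependent B H w"
  proof
    assume "rows_dependent B H w"
    then obtain a where a: "\<And>\<phi> F. \<phi> \<in> B \<Longrightarrow> F \<in> H \<Longrightarrow> \<exists>\<psi>\<in>B - {\<phi>}. a \<psi> + w \<psi> F \<le> a \<phi> + w \<phi> F"
      unfolding rows_dependent_def by blast
    have "tropically_dependent G B"
      unfolding tropically_dependent_def
    proof (intro exI[of _ a] ballI)
      fix p assume p: "p \<in> points G"
      have "B \<noteq> {}" using card by auto
      then obtain \<phi> where \<phi>: "\<phi> \<in> B" "\<And>\<chi>. \<chi> \<in> B \<Longrightarrow> \<phi> p + a \<phi> \<le> \<chi> p + a \<chi>"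
        using finite_attains_min[OF B(2), of "\<lambda>\<phi>. \<phi> p + a \<phi>"] by blast
      obtain F where F: "F \<in> H" "phi (w \<phi>) p = w \<phi> F + gap F p" using phi_attained[OF p] by blast
      obtain \<psi> where \<psi>: "\<psi> \<in> B" "\<psi> \<noteq> \<phi>" "a \<psi> + w \<psi> F \<le> a \<phi> + w \<phi> F" using a[OF \<phi>(1) F(1)] by blast
      have "\<psi> p \<le> w \<psi> F + gap F p" using phi_le[OF p F(1), of "w \<psi>"] w(2)[OF \<psi>(1)] by simp
      moreover have "\<phi> p = w \<phi> F + gap F p" using F(2) w(2)[OF \<phi>(1)] by simp
      ultimately have "\<psi> p + a \<psi> \<le> \<phi> p + a \<phi>" using \<psi>(3) by simp
      then have "\<forall>\<chi>\<in>B. \<psi> p + a \<psi> \<le> \<chi> p + a \<chi>" using \<phi>(2) by (meson order_trans)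
      then show "\<exists>\<phi>\<in>B. \<exists>\<psi>\<in>B. \<phi> \<noteq> \<psi> \<and> (\<forall>\<chi>\<in>B. \<phi> p + a \<phi> \<le> \<chi> p + a \<chi>) \<and> (\<forall>\<chi>\<in>B. \<psi> p + a \<psi> \<le> \<chi> p + a \<chi>)"
        using \<phi> \<psi> by blast
    qed
    then show False using ind by simp
  qed
  then obtain y i where yi: "\<And>\<phi>. \<phi> \<in> B \<Longrightarrow> i \<phi> \<in> H"
    "\<And>\<phi> \<psi>. \<phi> \<in> B \<Longrightarrow> \<psi> \<in> B \<Longrightarrow> \<psi> \<noteq> \<phi> \<Longrightarrow> y \<phi> + w \<phi> (i \<phi>) < y \<psi> + w \<psi> (i \<phi>)"
    using rows_dependent_or_separated[OF B(2) finite_H H_nonempty card(1), of w] by metis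
  let ?u = "\<lambda>\<phi> F. w \<phi> F + y \<phi>"
  have sep: "?u \<phi> (i \<phi>) < ?u \<psi> (i \<phi>)" if "\<phi> \<in> B" "\<psi> \<in> B" "\<psi> \<noteq> \<phi>" for \<phi> \<psi>
    using yi(2)[OF that] by simp
  have "i ` B \<in> indep W"
    by (rule separated_columns_indep[of B ?u]) (use B w weight_add yi(1) sep in auto)
  then have "card (i ` B) \<le> rk W H" by (rule W.card_le_rk) (use yi in auto)
  moreover have "inj_on i B" by (rule separated_columns_inj[of B ?u]) (rule sep)
  ultimately show False using card rk_H by (simp add: card_image)
qed

lemma basis_W:
  obtains I where "I \<in> indep W" "I \<subseteq> H" "card I = 3"
  by (rule W.rk_obtain[of H]) (use that rk_H in simp)

text \<open>The functions are those of the indicators of the three hyperplanes spanned by pairs from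
  a basis \<open>I\<close>; only \<open>\<beta> F\<close> vanishes at the vertex of
  \<open>F\<close>.\<close>

lemma independent_three: "\<exists>B\<subseteq>series. finite B \<and> \<not> tropically_dependent G B \<and> card B = 3"
proof -
  obtain I where I: "I \<in> indep W" "I \<subseteq> H" "card I = 3" by (rule basis_W)
  have finI: "finite I" using W.finite_indep I by blast
  define P where "P F = W.cl (I - {F})" for F
  define \<beta> where "\<beta> F = phi (\<lambda>X. if X \<in> P F then 1 else 0)" for F
  have iI: "I - {F} \<in> indep W" for F using W.indep_subset I by blast
  have P: "P F \<in> flats W" for F unfolding P_def by (rule W.cl_flat) (use I ground_W in auto)
  have IP: "X \<in> P F \<longleftrightarrow> X \<noteq> F" if "X \<in> I" "F \<in> I" for X F
  proof
    assume "X \<in> P F"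
    then have "X \<in> I - {F} \<or> insert X (I - {F}) \<notin> indep W"
      using W.cl_indep(1)[OF iI] by (simp add: P_def)
    then show "X \<noteq> F" using I(1) that by (auto simp: insert_absorb)
  qed (use W.cl_superset[of "I - {F}"] that in \<open>auto simp: P_def\<close>)
  have val: "\<beta> F (Vertex (Inr X)) = (if X = F then 0 else 1)" if "X \<in> I" "F \<in> I" for X F
  proof -
    have "low (\<lambda>X. if X \<in> P F then 1 else 0) = 0"
      by (rule low_eqI[of F]) (use that I IP in auto)
    moreover have "X \<in> H" using that I by blast
    ultimately show ?thesis using phi_line[of X] IP[OF that] by (simp add: \<beta>_def)
  qed
  have inj: "inj_on \<beta> I"
    by (rule inj_onI) (metis val zero_neq_one)
  have "\<not> tropically_dependent G (\<beta> ` I)"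
  proof
    assume "tropically_dependent G (\<beta> ` I)"
    then obtain a where a: "\<And>p. p \<in> points G \<Longrightarrow> \<exists>\<phi>\<in>\<beta> ` I. \<exists>\<psi>\<in>\<beta> ` I. \<phi> \<noteq> \<psi> \<and>
        (\<forall>\<chi>\<in>\<beta> ` I. \<phi> p + a \<phi> \<le> \<chi> p + a \<chi>) \<and> (\<forall>\<chi>\<in>\<beta> ` I. \<psi> p + a \<psi> \<le> \<chi> p + a \<chi>)"
      unfolding tropically_dependent_def by blast
    \<comment> \<open>For the smallest shift, \<open>\<beta> F\<close> is the only minimum at the
      vertex of \<open>F\<close>.\<close>
    have "I \<noteq> {}" using I by auto
    then obtain F where F: "F \<in> I" "\<And>X. X \<in> I \<Longrightarrow> a (\<beta> F) \<le> a (\<beta> X)"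
      using finite_attains_min[OF finI, of "\<lambda>F. a (\<beta> F)"] by blast
    have "Vertex (Inr F) \<in> points G" using F I by (auto simp: points_G)
    from a[OF this] obtain X where X: "X \<in> I" "X \<noteq> F"
      "\<beta> X (Vertex (Inr F)) + a (\<beta> X) \<le> \<beta> F (Vertex (Inr F)) + a (\<beta> F)"
      using F(1) by blast
    then show False using val[OF F(1) X(1)] val[OF F(1) F(1)] F(2)[OF X(1)] by simp
  qed
  moreover have "\<beta> ` I \<subseteq> series" using weight_indicator P by (auto simp: \<beta>_def series_def)
  ultimately show ?thesis using finI I inj by (intro exI[of _ "\<beta> ` I"]) (simp add: card_image)
qed

lemma series_r_ind: "is_r_ind G series 3"
  unfolding is_r_ind_def using independent_three independent_card_le by blast

text \<open>A line with a chip has weight above the minimum, so chips on the three lines of a basis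
  would put this basis into a proper flat.\<close>

lemma BN_upper:
  assumes "r \<in> BN_values G D series"
  shows "r \<le> 2"
proof (rule ccontr)
  assume r: "\<not> r \<le> 2"
  obtain I where I: "I \<in> indep W" "I \<subseteq> H" "card I = 3" by (rule basis_W)
  then obtain F1 F2 F3 where F: "I = {F1, F2, F3}" "F1 \<noteq> F2" "F1 \<noteq> F3" "F2 \<noteq> F3"
    by (auto simp: card_3_iff)
  \<comment> \<open>The chips beyond three are stacked on \<open>F1\<close>, which treats every
    \<open>r > 2\<close> at once.\<close>
  define D' where "D' p = (if p = Vertex (Inr F1) then r - 2 else
      if p = Vertex (Inr F2) \<or> p = Vertex (Inr F3) then 1 else 0)"
    for p :: "('a + 'a set, 'a \<times> 'a set) point"
  have supp: "{p. D' p \<noteq> 0} = {Vertex (Inr F1), Vertex (Inr F2), Vertex (Inr F3)}"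
    using r by (auto simp: D'_def)
  have "is_divisor G D'" unfolding is_divisor_def supp using I F by (auto simp: points_G)
  moreover have "effective D'" using r by (auto simp: effective_def D'_def)
  moreover have "divisor_degree D' = r" unfolding divisor_degree_def supp using F by (simp add: D'_def)
  ultimately obtain w where w: "weight w" "effective (\<lambda>p. D p - D' p + divis G (phi w) p)"
    using assms unfolding BN_values_def series_def by blast
  have "low w < w F" if "F \<in> I" for F
  proof -
    have "0 < D' (Vertex (Inr F))" using that F r by (auto simp: D'_def)
    moreover have "0 \<le> D (Vertex (Inr F)) - D' (Vertex (Inr F)) + divis G (phi w) (Vertex (Inr F))"
      using w(2) unfolding effective_def by blast
    ultimately have "0 < chips w (Vertex (Inr F))" by (simp add: chips_def)
    then show ?thesis using chips_line(3)[OF w(1)] that I by blast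
  qed
  then have "I \<subseteq> {F \<in> H. low w < w F}" using I by blast
  then have "3 \<le> rk W {F \<in> H. low w < w F}" using W.card_le_rk I by metis
  moreover have "{F \<in> H. low w < w F} \<noteq> ground W" using low_attained[of w] ground_W by force
  ultimately show False using W.rk_proper_flat[OF weight_strict[OF w(1), of "low w"]] rank_W by simp
qed

section \<open>The Brill--Noether rank\<close>

text \<open>All pairs of chips can be reached by weights that are constant along the flag of flats
  \<open>{F} \<subseteq> P\<close> of the adjoint.\<close>

definition flag :: "'a set set \<Rightarrow> 'a set \<Rightarrow> real \<Rightarrow> real \<Rightarrow> 'a set \<Rightarrow> real" where
  "flag P F a b = (\<lambda>X. if X = F then b else if X \<in> P then a else 0)"

text \<open>A chip of \<open>phi w\<close> at distance \<open>t\<close> from \<open>e\<close> on the edge from \<open>e\<close> to \<open>F\<close>, for \<open>low w = 0\<close>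
  and \<open>A = alow w e\<close>.\<close>

definition tied :: "real \<Rightarrow> real \<Rightarrow> real \<Rightarrow> bool" where
  "tied x A t \<longleftrightarrow> (if t = 1 then x = 1 else
     x = A + t \<and> A + t \<le> 2 - t \<or> x = 2 - t \<and> 2 - t \<le> A + t \<or> A + t = 2 - t \<and> A + t \<le> x)"

lemma chips_tied:
  assumes w: "weight w" "low w = 0" and F: "F \<in> H" "e \<in> F" and t: "0 < t" "t \<le> 1"
    and tie: "tied (w F) (alow w e) t"
  shows "1 \<le> chips w (edge_point G (e, F) t)"
proof (cases "t = 1")
  case True
  then show ?thesis using tie chips_line(2)[OF w(1) F(1)] w(2) F by (simp add: edge_point_G tied_def)
next
  case False
  then show ?thesis using tie chips_inner(2)[OF F t(1), of w] w(2) F t by (simp add: edge_point_G tied_def)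
qed

context
  fixes P F and a b :: real
  assumes P: "P \<in> flats W" "P \<noteq> H" "F \<in> P" and ab: "0 \<le> a" "a \<le> b"
begin

lemma weight_of_flag: "weight (flag P F a b)"
  unfolding flag_def by (rule weight_flag) (use P ab in auto)

lemma flag_nonneg: "0 \<le> flag P F a b X"
  using ab by (simp add: flag_def)

lemma low_flag: "low (flag P F a b) = 0"
proof -
  obtain X where "X \<in> H" "X \<notin> P" using P W.flat_subset ground_W by blast
  then show ?thesis using P by (intro low_eqI[of X] flag_nonneg) (auto simp: flag_def)
qed

text \<open>A star different from \<open>P\<close> is not contained in it, as stars are maximal, and
  so has a line of weight 0. If the star is \<open>P\<close> and \<open>a = 0\<close>, any of its
  lines other than \<open>F\<close> will do.\<close>

lemma alow_flag_other:
  assumes "e \<in> ground M" "star e \<noteq> P \<or> a = 0"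
  shows "alow (flag P F a b) e = 0"
proof -
  have "\<exists>X\<in>star e. X \<noteq> F \<and> (X \<in> P \<longrightarrow> a = 0)"
  proof (cases "star e = P")
    case True
    have "\<not> star e \<subseteq> {F}" using star_card[OF assms(1)] card_mono[of "{F}" "star e"] by auto
    then show ?thesis using assms(2) True by auto
  next
    case False
    then have "\<not> star e \<subseteq> P" using star_maximal[OF assms(1) P(1,2)] by blast
    then show ?thesis using P by auto
  qed
  then obtain X where "X \<in> H" "e \<in> X" "X \<noteq> F" "X \<in> P \<longrightarrow> a = 0" by (auto simp: star_def)
  then show ?thesis by (intro alow_eqI[of X] flag_nonneg) (auto simp: flag_def)
qed

lemma alow_flag_star:
  assumes "e \<in> ground M" "star e = P"
  shows "alow (flag P F a b) e = a"
proof -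
  have "\<not> star e \<subseteq> {F}" using star_card[OF assms(1)] card_mono[of "{F}" "star e"] by auto
  then obtain X where X: "X \<in> star e" "X \<noteq> F" by blast
  show ?thesis
    by (rule alow_eqI[of X]) (use X assms ab in \<open>auto simp: flag_def star_def\<close>)
qed

lemma alow_flag_ge: "e \<in> ground M \<Longrightarrow> 0 \<le> alow (flag P F a b) e"
  using low_le_alow low_flag by metis

lemmas flag_simps = weight_of_flag low_flag alow_flag_other alow_flag_star

end

lemma star_proper: "e \<in> ground M \<Longrightarrow> star e \<noteq> H"
  using star_flat(2)[of e] rk_H by auto

lemma singleton_proper: "{F} \<noteq> H"
proof
  assume "{F} = H"
  then have "rk W {F} = 3" using rk_H by simp
  then show False using W.rk_le_card[of "{F}"] by simp
qed

lemma in_star: "F \<in> H \<Longrightarrow> e \<in> F \<Longrightarrow> F \<in> star e"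
  by (simp add: star_def)

lemma in_ground: "F \<in> H \<Longrightarrow> e \<in> F \<Longrightarrow> e \<in> ground M"
  using H_subset by blast

lemma two_chips_elem:
  assumes e: "e \<in> ground M"
  shows "\<exists>w. weight w \<and> 2 \<le> chips w (Vertex (Inl e))"
proof -
  obtain F where F: "F \<in> star e" using star_nonempty[OF e] by blast
  note fl = star_flat(1)[OF e] star_proper[OF e] F
  show ?thesis
    by (rule exI[of _ "flag (star e) F 2 2"])
      (use flag_simps[OF fl, of 2 2] chips_elem(3)[OF e, of "flag (star e) F 2 2"] e in simp)
qed

lemma two_chips_edge:
  assumes F: "F \<in> H" "e \<in> F" and t: "0 < t" "t \<le> 1"
  shows "\<exists>w. weight w \<and> 2 \<le> chips w (edge_point G (e, F) t)"
proof -
  have e: "e \<in> ground M" using in_ground F by blast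
  note fl = star_flat(1)[OF e] star_proper[OF e] in_star[OF F]
  \<comment> \<open>Chosen so that all three branches meet at \<open>t\<close>. For
    \<open>t = 1\<close> the value 0 on \<open>star e\<close> makes every element of
    \<open>F\<close> contribute a chip.\<close>
  let ?w = "flag (star e) F (2 - 2 * t) (2 - t)"
  have w: "weight ?w" "low ?w = 0" "alow ?w e = 2 - 2 * t" "?w F = 2 - t"
    using flag_simps[OF fl, of "2 - 2 * t" "2 - t"] t e by (auto simp: flag_def)
  have "2 \<le> chips ?w (edge_point G (e, F) t)"
  proof (cases "t = 1")
    case True
    have "alow ?w e' = 0" if "e' \<in> F" for e'
      using alow_flag_other[OF fl, of 0 1 e'] that True in_ground F by simp
    then show ?thesis using chips_line_two[OF F(1), of ?w] w True F by (simp add: edge_point_G)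
  next
    case False
    then show ?thesis using chips_inner(3)[OF F t(1), of ?w] w F t by (simp add: edge_point_G)
  qed
  then show ?thesis using w by blast
qed

lemma chips_elem_elem:
  assumes "e \<in> ground M" "e' \<in> ground M"
  shows "\<exists>w. weight w \<and> 1 \<le> chips w (Vertex (Inl e)) \<and> 1 \<le> chips w (Vertex (Inl e'))"
proof -
  have "1 \<le> chips (\<lambda>_. 0) (Vertex (Inl e))" if "e \<in> ground M" for e
    by (rule chips_elem(2)[OF that]) (use alow_attained[OF that, of "\<lambda>_. 0"] in auto)
  then show ?thesis using assms weight_const by blast
qed

lemma chips_elem_edge:
  assumes e: "e \<in> ground M" and F: "F \<in> H" "e' \<in> F" and t: "0 < t" "t \<le> 1"
  shows "\<exists>w. weight w \<and> 1 \<le> chips w (Vertex (Inl e)) \<and> 1 \<le> chips w (edge_point G (e', F) t)"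
proof -
  have e': "e' \<in> ground M" using in_ground F by blast
  show ?thesis
  proof (cases "e \<in> F")
    case False
    \<comment> \<open>Only \<open>F\<close> is raised, so the lines through \<open>e\<close> keep
      weight 0 and the chip at \<open>e\<close> stays.\<close>
    let ?w = "flag {F} F t t"
    note fl = singleton_flat[OF F(1)] singleton_proper[of F] singletonI[of F]
    have ne: "star e' \<noteq> {F}" using star_card[OF e'] by auto
    have w: "weight ?w" "low ?w = 0" "alow ?w e' = 0" "?w F = t"
      using flag_simps(1,2)[OF fl, of t t] alow_flag_other[OF fl, of t t e'] ne e' t by (auto simp: flag_def)
    have "1 \<le> chips ?w (edge_point G (e', F) t)"
      by (rule chips_tied[OF w(1,2) F t]) (use w t in \<open>simp add: tied_def\<close>)
    moreover have "1 \<le> chips ?w (Vertex (Inl e))"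
    proof (rule chips_elem(2)[OF e])
      fix X assume "X \<in> H" "e \<in> X"
      then have "?w X = 0" using False by (auto simp: flag_def)
      then show "?w X \<le> alow ?w e" using alow_flag_ge[OF fl, of t t] t e by simp
    qed
    ultimately show ?thesis using w by blast
  next
    case True
    note fl = star_flat(1)[OF e] star_proper[OF e] in_star[OF F(1) True]
    \<comment> \<open>A constant weight on \<open>star e\<close> keeps the chip at \<open>e\<close>.
      On the edge, \<open>w F\<close> ties with \<open>alow w e' + t = t\<close> if
      \<open>e' \<noteq> e\<close>, and with \<open>2 - t\<close> if \<open>e' = e\<close>.\<close>
    define s where "s = (if e' = e then 2 - t else t)"
    let ?w = "flag (star e) F s s"
    have s: "0 \<le> s" "s \<le> s" using t by (auto simp: s_def)
    have ne: "star e' \<noteq> star e" if "e' \<noteq> e" using star_inj[OF e' e] that by blast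
    have w: "weight ?w" "low ?w = 0" "alow ?w e = s" "?w F = s"
      using flag_simps[OF fl s] e by (auto simp: flag_def)
    have w': "e' \<noteq> e \<Longrightarrow> alow ?w e' = 0" using alow_flag_other[OF fl s e'] ne by blast
    have "1 \<le> chips ?w (edge_point G (e', F) t)"
      by (rule chips_tied[OF w(1,2) F t]) (use w w' t in \<open>auto simp: tied_def s_def\<close>)
    moreover have "1 \<le> chips ?w (Vertex (Inl e))"
      by (rule chips_elem(2)[OF e]) (use w in \<open>auto simp: flag_def star_def\<close>)
    ultimately show ?thesis using w by blast
  qed
qed

lemma chips_same_line:
  assumes F: "F \<in> H" "e1 \<in> F" "e2 \<in> F" and t: "0 < t1" "t1 \<le> t2" "t2 \<le> 1"
  shows "\<exists>w. weight w \<and> 1 \<le> chips w (edge_point G (e1, F) t1) \<and> 1 \<le> chips w (edge_point G (e2, F) t2)"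
proof -
  have e: "e1 \<in> ground M" "e2 \<in> ground M" using in_ground F by blast+
  note fl = star_flat(1)[OF e(1)] star_proper[OF e(1)] in_star[OF F(1,2)]
  \<comment> \<open>On a common edge the function rises to \<open>b\<close> at \<open>t1\<close>, is
    constant up to \<open>t2\<close>, and falls afterwards. On different edges \<open>e2\<close> has
    minimum 0, and the minimum \<open>a\<close> at \<open>e1\<close> moves the tie from
    \<open>t2\<close> back to \<open>t1\<close>.\<close>
  define a where "a = (if e1 = e2 then 2 - t1 - t2 else t2 - t1)"
  define b where "b = (if e1 = e2 then 2 - t2 else t2)"
  have ab: "0 \<le> a" "a \<le> b" using t by (auto simp: a_def b_def)
  let ?w = "flag (star e1) F a b"
  have w: "weight ?w" "low ?w = 0" "alow ?w e1 = a" "?w F = b"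
    using flag_simps[OF fl ab] e by (auto simp: flag_def)
  have w2: "e1 \<noteq> e2 \<Longrightarrow> alow ?w e2 = 0"
    using alow_flag_other[OF fl ab e(2)] star_inj[OF e] by metis
  have "1 \<le> chips ?w (edge_point G (e1, F) t1)"
    by (rule chips_tied[OF w(1,2) F(1,2)]) (use w t in \<open>auto simp: tied_def a_def b_def\<close>)
  moreover have "1 \<le> chips ?w (edge_point G (e2, F) t2)"
    by (rule chips_tied[OF w(1,2) F(1,3)]) (use w w2 t in \<open>auto simp: tied_def a_def b_def\<close>)
  ultimately show ?thesis using w by blast
qed

text \<open>The value \<open>a\<close> makes the branch \<open>w F1\<close> tie at
  \<open>t1\<close>, and \<open>b\<close> the branch \<open>w F2\<close> at \<open>t2\<close>. The
  tying branch depends on whether the star of the element is \<open>P\<close>, since its minimum is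
  then \<open>a\<close> instead of 0. The assumption \<open>wlog\<close> secures
  \<open>a \<le> b\<close>; the other cases follow by exchanging the chips.\<close>

lemma chips_distinct_lines:
  assumes F: "F1 \<in> H" "F2 \<in> H" "F1 \<noteq> F2" and e: "e1 \<in> F1" "e2 \<in> F2"
    and t: "0 < t1" "t1 \<le> 1" "0 < t2" "t2 \<le> 1"
    and P: "P \<in> flats W" "P \<noteq> H" "F1 \<in> P" "F2 \<in> P"
    and wlog: "star e1 \<noteq> P \<and> star e2 \<noteq> P \<and> t1 \<le> t2 \<or> star e1 = P \<and> star e2 = P \<and> t2 \<le> t1
      \<or> star e2 = P \<and> star e1 \<noteq> P"
  shows "\<exists>w. weight w \<and> 1 \<le> chips w (edge_point G (e1, F1) t1) \<and> 1 \<le> chips w (edge_point G (e2, F2) t2)"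
proof -
  have g: "e1 \<in> ground M" "e2 \<in> ground M" using in_ground F e by blast+
  define a where "a = (if star e1 = P then 2 - t1 else t1)"
  define b where "b = (if star e2 = P then min (a + t2) (2 - t2) else t2)"
  have ab: "0 \<le> a" "a \<le> b" using t wlog by (auto simp: a_def b_def)
  note fl = P(1,2,4) ab
  let ?w = "flag P F2 a b"
  have w: "weight ?w" "low ?w = 0" "?w F1 = a" "?w F2 = b"
    using flag_simps(1,2)[OF fl] F P by (auto simp: flag_def)
  have al: "alow ?w e = (if star e = P then a else 0)" if "e \<in> ground M" for e
    using alow_flag_other[OF fl that] alow_flag_star[OF fl that] by simp
  have "1 \<le> chips ?w (edge_point G (e1, F1) t1)"
    by (rule chips_tied[OF w(1,2) F(1) e(1) t(1,2)]) (use w al[OF g(1)] t in \<open>auto simp: tied_def a_def\<close>)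
  moreover have "1 \<le> chips ?w (edge_point G (e2, F2) t2)"
    by (rule chips_tied[OF w(1,2) F(2) e(2) t(3,4)])
      (use w al[OF g(2)] t wlog in \<open>auto simp: tied_def b_def a_def min_def split: if_splits\<close>)
  ultimately show ?thesis using w by blast
qed

lemma chips_edge_edge:
  assumes F: "F1 \<in> H" "e1 \<in> F1" "F2 \<in> H" "e2 \<in> F2" and t: "0 < t1" "t1 \<le> 1" "0 < t2" "t2 \<le> 1"
  shows "\<exists>w. weight w \<and> 1 \<le> chips w (edge_point G (e1, F1) t1) \<and> 1 \<le> chips w (edge_point G (e2, F2) t2)"
proof (cases "F1 = F2")
  case True
  then show ?thesis
    using chips_same_line[of F1 e1 e2 t1 t2] chips_same_line[of F1 e2 e1 t2 t1] F t by fastforce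
next
  case False
  obtain P where P: "P \<in> flats W" "P \<noteq> H" "F1 \<in> P" "F2 \<in> P" using two_lines[OF F(1,3) False] by blast
  consider "star e1 \<noteq> P \<and> star e2 \<noteq> P \<and> t1 \<le> t2 \<or> star e1 = P \<and> star e2 = P \<and> t2 \<le> t1
      \<or> star e2 = P \<and> star e1 \<noteq> P"
    | "star e2 \<noteq> P \<and> star e1 \<noteq> P \<and> t2 \<le> t1 \<or> star e2 = P \<and> star e1 = P \<and> t1 \<le> t2
      \<or> star e1 = P \<and> star e2 \<noteq> P"
    by linarith
  then show ?thesis
  proof cases
    case 1
    show ?thesis by (rule chips_distinct_lines[OF F(1,3) False F(2,4) t P 1])
  next
    case 2
    show ?thesis
      using chips_distinct_lines[OF F(3,1) False[symmetric] F(4,2) t(3,4,1,2) P(1,2,4,3) 2] by blast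
  qed
qed

text \<open>A line vertex is the end \<open>t = 1\<close> of an edge, since lines are nonempty; so
  it can be treated together with interior points.\<close>

lemma point_cases_edge:
  assumes "p \<in> points G"
  obtains (elem) e where "e \<in> ground M" "p = Vertex (Inl e)"
  | (edge) e F t where "F \<in> H" "e \<in> F" "0 < t" "t \<le> 1" "p = edge_point G (e, F) t"
  using assms
proof (cases rule: point_cases)
  case (line F)
  then obtain e where "e \<in> F" using line_card[of F] by fastforce
  then show ?thesis using line edge[of F e 1] by (simp add: edge_point_G)
next
  case (inner e F t)
  then show ?thesis using edge[of F e t] by (simp add: edge_point_G)
qed (use elem in blast)

lemma BN_lower: "2 \<in> BN_values G D series"
  unfolding BN_values_def
proof (intro CollectI allI impI)
  fix D' :: "('a + 'a set, 'a \<times> 'a set) point \<Rightarrow> int"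
  assume "is_divisor G D' \<and> effective D' \<and> divisor_degree D' = 2"
  then obtain p q where pq: "p \<in> points G" "q \<in> points G"
    "D' = (\<lambda>x. (if x = p then 1 else 0) + (if x = q then 1 else 0))"
    using effective_degree_two[of G D'] by blast
  have "\<exists>w. weight w \<and> (\<forall>x. D' x \<le> chips w x)"
  proof (cases "p = q")
    case True
    have "\<exists>w. weight w \<and> 2 \<le> chips w p"
      using pq(1) by (cases rule: point_cases_edge) (use two_chips_elem two_chips_edge in auto)
    then show ?thesis using chips_nonneg True pq(3) by auto
  next
    case False
    have "\<exists>w. weight w \<and> 1 \<le> chips w p \<and> 1 \<le> chips w q"
      using pq(1)
    proof (cases rule: point_cases_edge)
      case p: (elem e)
      show ?thesis using pq(2)
        by (cases rule: point_cases_edge) (use p chips_elem_elem chips_elem_edge in simp_all)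
    next
      case p: (edge e F t)
      show ?thesis using pq(2)
      proof (cases rule: point_cases_edge)
        case (elem e')
        then show ?thesis using chips_elem_edge[of e' F e t] p by blast
      next
        case (edge e' F' t')
        then show ?thesis using chips_edge_edge[of F e F' e' t t'] p by blast
      qed
    qed
    then show ?thesis using chips_nonneg False pq(3) by auto
  qed
  then obtain w where "weight w" "\<And>x. D' x \<le> chips w x" by blast
  then show "\<exists>\<phi>\<in>series. effective (\<lambda>p. D p - D' p + divis G \<phi> p)"
    unfolding series_def effective_def chips_def
    by (intro bexI[of _ "phi w"]) (auto simp: algebra_simps)
qed

lemma series_r_BN: "is_r_BN G D series 2"
  unfolding is_r_BN_def using BN_lower BN_upper by blast

lemma series_linear: "tropical_linear_series G D 2 series"
  unfolding tropical_linear_series_def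
  using series_submodule series_finitely_generated series_r_BN series_r_ind by simp

section \<open>The homomorphism from the valuated matroid\<close>

text \<open>\<open>phi\<close> for vectors with infinite entries, as the homomorphism has to be
  defined on the whole valuated matroid.\<close>

definition ephi :: "('a set \<Rightarrow> ereal) \<Rightarrow> ('a + 'a set, 'a \<times> 'a set) point \<Rightarrow> ereal" where
  "ephi x = (\<lambda>p\<in>points G. Min ((\<lambda>F. x F + ereal (gap F p)) ` H))"

lemma ephi_eqI:
  assumes p: "p \<in> points G" and "F \<in> H" "x F + ereal (gap F p) = y"
    and "\<And>X. X \<in> H \<Longrightarrow> y \<le> x X + ereal (gap X p)"
  shows "ephi x p = y"
  unfolding ephi_def using assms finite_H by (auto intro!: Min_eqI)

lemma ephi_le: "p \<in> points G \<Longrightarrow> F \<in> H \<Longrightarrow> ephi x p \<le> x F + ereal (gap F p)"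
  unfolding ephi_def using finite_H by (simp add: Min_le)

lemma ephi_attained: "p \<in> points G \<Longrightarrow> \<exists>F\<in>H. ephi x p = x F + ereal (gap F p)"
proof -
  assume p: "p \<in> points G"
  have "Min ((\<lambda>F. x F + ereal (gap F p)) ` H) \<in> (\<lambda>F. x F + ereal (gap F p)) ` H"
    using finite_H H_nonempty by (intro Min_in) auto
  then show ?thesis using p by (auto simp: ephi_def)
qed

lemma ephi_cong: "(\<And>F. F \<in> H \<Longrightarrow> x F = y F) \<Longrightarrow> ephi x = ephi y"
  unfolding ephi_def by (intro restrict_ext arg_cong[where f = Min] image_cong) auto

lemma ephi_min: "ephi (\<lambda>F. min (x F) (y F)) = tmin (points G) (ephi x) (ephi y)"
proof
  fix p
  show "ephi (\<lambda>F. min (x F) (y F)) p = tmin (points G) (ephi x) (ephi y) p"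
  proof (cases "p \<in> points G")
    case p: True
    obtain F1 F2 where F: "F1 \<in> H" "ephi x p = x F1 + gap F1 p" "F2 \<in> H" "ephi y p = y F2 + gap F2 p"
      using ephi_attained[OF p, of x] ephi_attained[OF p, of y] by blast
    have le: "ephi x p \<le> x X + gap X p" "ephi y p \<le> y X + gap X p" if "X \<in> H" for X
      using ephi_le[OF p that] by auto
    have mono: "min (x X) (y X) + gap X p = min (x X + gap X p) (y X + gap X p)" for X
      by (cases "x X \<le> y X") (simp_all add: min_def add_right_mono ereal_add_le_add_iff2)
    have "ephi (\<lambda>F. min (x F) (y F)) p = min (ephi x p) (ephi y p)"
    proof (rule antisym)
      show "ephi (\<lambda>F. min (x F) (y F)) p \<le> min (ephi x p) (ephi y p)"
        using ephi_le[OF p F(1), of "\<lambda>F. min (x F) (y F)"] ephi_le[OF p F(3), of "\<lambda>F. min (x F) (y F)"]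
        unfolding mono F(2,4) by simp
      obtain X where X: "X \<in> H" "ephi (\<lambda>F. min (x F) (y F)) p = min (x X) (y X) + gap X p"
        using ephi_attained[OF p] by blast
      show "min (ephi x p) (ephi y p) \<le> ephi (\<lambda>F. min (x F) (y F)) p"
        unfolding X(2) mono using le[OF X(1)] by (simp add: min_le_iff_disj)
    qed
    then show ?thesis using p by (simp add: tmin_def)
  qed (simp add: ephi_def tmin_def)
qed

lemma ephi_add: "ephi (\<lambda>F. x F + a) = tscale (points G) a (ephi x)"
proof
  fix p
  show "ephi (\<lambda>F. x F + a) p = tscale (points G) a (ephi x) p"
  proof (cases "p \<in> points G")
    case p: True
    obtain F where F: "F \<in> H" "ephi x p = x F + gap F p" using ephi_attained[OF p] by blast
    have "ephi (\<lambda>F. x F + a) p = ephi x p + a"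
    proof (rule ephi_eqI[OF p F(1)])
      show "ephi x p + a \<le> x X + a + gap X p" if "X \<in> H" for X
        using add_right_mono[OF ephi_le[OF p that, of x], of a] by (simp add: ac_simps)
    qed (simp add: F(2) ac_simps)
    then show ?thesis using p by (simp add: tscale_def)
  qed (simp add: ephi_def tscale_def)
qed

lemma ephi_top: "ephi (\<lambda>F. \<infinity>) = (\<lambda>p\<in>points G. \<infinity>)"
proof
  fix p
  obtain F where "F \<in> H" using H_nonempty by blast
  then show "ephi (\<lambda>F. \<infinity>) p = (\<lambda>p\<in>points G. \<infinity>) p"
    using ephi_eqI[of p F "\<lambda>F. \<infinity>" \<infinity>] by (cases "p \<in> points G") (auto simp: ephi_def)
qed

lemma ephi_real: "ephi (\<lambda>F. ereal (w F)) = (\<lambda>p\<in>points G. ereal (phi w p))"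
proof
  fix p
  show "ephi (\<lambda>F. ereal (w F)) p = (\<lambda>p\<in>points G. ereal (phi w p)) p"
  proof (cases "p \<in> points G")
    case p: True
    obtain F where F: "F \<in> H" "phi w p = w F + gap F p" using phi_attained[OF p] by blast
    have "ephi (\<lambda>F. ereal (w F)) p = ereal (phi w p)"
      by (rule ephi_eqI[OF p F(1)]) (simp_all add: F(2)[symmetric] phi_le[OF p])
    then show ?thesis using p by simp
  qed (simp add: ephi_def)
qed

text \<open>Gaps are at most 2, so the entry \<open>c\<close> bounds all values by
  \<open>c + 2\<close>, and larger entries, infinite ones included, may be lowered to
  \<open>c + 2\<close>. Hence a vector with some finite entry maps to a real-valued
  function.\<close>

lemma ephi_truncate:
  assumes F0: "F0 \<in> H" "x F0 = ereal c"
  shows "ephi (\<lambda>F. min (x F) (ereal (c + 2))) = ephi x"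
proof
  fix p
  show "ephi (\<lambda>F. min (x F) (ereal (c + 2))) p = ephi x p"
  proof (cases "p \<in> points G")
    case p: True
    have "ephi x p \<le> ereal (c + 2)"
      using ephi_le[OF p F0(1), of x] gap_bounds[OF p, of F0] F0(2)
      by (auto intro: order_trans)
    also have "ereal (c + 2) \<le> ephi (\<lambda>F. ereal (c + 2)) p"
    proof -
      obtain X where X: "X \<in> H" "ephi (\<lambda>F. ereal (c + 2)) p = ereal (c + 2) + gap X p"
        using ephi_attained[OF p] by blast
      show ?thesis unfolding X(2) using gap_bounds[OF p, of X] by simp
    qed
    finally have "ephi x p \<le> ephi (\<lambda>F. ereal (c + 2)) p" .
    then show ?thesis using p unfolding ephi_min by (simp add: tmin_def min_absorb1)
  qed (simp add: ephi_def)
qed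

lemma weight_truncate:
  assumes x: "\<And>c. {F \<in> H. ereal c \<le> x F} \<in> flats W"
    and w: "\<And>F. F \<in> H \<Longrightarrow> ereal (w F) = min (x F) (ereal b)"
  shows "weight w"
  unfolding weight_def
proof
  fix c
  have "c \<le> w F \<longleftrightarrow> ereal c \<le> x F \<and> c \<le> b" if "F \<in> H" for F
  proof -
    have "c \<le> w F \<longleftrightarrow> ereal c \<le> ereal (w F)" by simp
    then show ?thesis unfolding w[OF that] by simp
  qed
  then have "{F \<in> H. c \<le> w F} = (if c \<le> b then {F \<in> H. ereal c \<le> x F} else {})" by auto
  then show "{F \<in> H. c \<le> w F} \<in> flats W" using x empty_flat by simp
qed

lemma series_matroidal: "matroidal_linear_series G D 2 series"
  unfolding matroidal_linear_series_def
proof (intro conjI)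
  obtain g :: "'a set \<Rightarrow> nat" where "inj_on g H"
    using finite_imp_inj_to_nat_seg[OF finite_H] by blast
  then obtain U where U: "is_matroid U" "ground U = g ` H" "matroid_rank U = 3"
    "\<And>X. X \<subseteq> H \<Longrightarrow> g ` X \<in> flats U \<longleftrightarrow> X \<in> flats W"
    using matroid_transport[OF W.matroid, of g] ground_W rank_W by metis
  interpret U: finite_matroid U by unfold_locales (rule U(1))
  define f where "f v = ephi (\<lambda>F. v (g F))" for v
  have level: "{i \<in> ground U. c \<le> v i} \<in> flats U \<longleftrightarrow> {F \<in> H. c \<le> v (g F)} \<in> flats W"
    for v :: "nat \<Rightarrow> ereal" and c
  proof -
    have "{i \<in> ground U. c \<le> v i} = g ` {F \<in> H. c \<le> v (g F)}" by (auto simp: U(2))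
    then show ?thesis using U(4)[of "{F \<in> H. c \<le> v (g F)}"] by auto
  qed
  have hom: "tropical_hom (ground U) (flag_vectors U) (points G) f"
    unfolding tropical_hom_def
  proof (intro conjI ballI allI impI)
    fix w w'
    have "f (tmin (ground U) w w') = ephi (\<lambda>F. min (w (g F)) (w' (g F)))"
      unfolding f_def by (rule ephi_cong) (simp add: tmin_def U(2))
    then show "f (tmin (ground U) w w') = tmin (points G) (f w) (f w')"
      by (simp add: ephi_min f_def)
  next
    fix w :: "nat \<Rightarrow> ereal" and a
    have "f (tscale (ground U) a w) = ephi (\<lambda>F. w (g F) + a)"
      unfolding f_def by (rule ephi_cong) (simp add: tscale_def U(2))
    then show "f (tscale (ground U) a w) = tscale (points G) a (f w)"
      by (simp add: ephi_add f_def)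
  qed
  have "f ` flag_vectors U = adjoin_zero G series"
  proof (intro equalityI subsetI)
    fix \<psi> assume "\<psi> \<in> f ` flag_vectors U"
    then obtain v where v: "v \<in> flag_vectors U" "\<psi> = f v" by blast
    have vH: "v (g F) \<noteq> -\<infinity>" if "F \<in> H" for F
      using v(1) that U(2) by (auto simp: flag_vectors_def PiE_iff)
    show "\<psi> \<in> adjoin_zero G series"
    proof (cases "\<forall>F\<in>H. v (g F) = \<infinity>")
      case True
      then have "f v = ephi (\<lambda>F. \<infinity>)" unfolding f_def by (intro ephi_cong) simp
      then show ?thesis using v(2) ephi_top by (simp add: adjoin_zero_def)
    next
      case False
      \<comment> \<open>The least entry is finite here; capping at \<open>c + 2\<close> turns
        \<open>v\<close> into a real weight with the same image.\<close>
      obtain F0 where F0: "F0 \<in> H" "\<And>F. F \<in> H \<Longrightarrow> v (g F0) \<le> v (g F)"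
        using finite_attains_min[OF finite_H H_nonempty, of "\<lambda>F. v (g F)"] by blast
      then obtain c where c: "v (g F0) = ereal c"
        using False vH[OF F0(1)] by (cases "v (g F0)") (auto simp: top_unique)
      define w where "w F = real_of_ereal (min (v (g F)) (ereal (c + 2)))" for F
      have w: "ereal (w F) = min (v (g F)) (ereal (c + 2))" if "F \<in> H" for F
        unfolding w_def using vH[OF that] by (cases "v (g F)") (auto simp: min_def)
      have "weight w"
      proof (rule weight_truncate[OF _ w])
        fix c
        have "{i \<in> ground U. ereal c \<le> v i} \<in> flats U" using v(1) by (simp add: flag_vectors_def)
        then show "{F \<in> H. ereal c \<le> v (g F)} \<in> flats W" using level by blast
      qed
      moreover have "f v = (\<lambda>p\<in>points G. ereal (phi w p))"
      proof -
        have "f v = ephi (\<lambda>F. min (v (g F)) (ereal (c + 2)))"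
          unfolding f_def using ephi_truncate[of F0 "\<lambda>F. v (g F)" c] F0(1) c by simp
        also have "\<dots> = ephi (\<lambda>F. ereal (w F))" by (rule ephi_cong) (simp add: w)
        finally show ?thesis by (simp add: ephi_real)
      qed
      ultimately show ?thesis using v(2) by (auto simp: adjoin_zero_def series_def)
    qed
  next
    fix \<psi> assume "\<psi> \<in> adjoin_zero G series"
    then consider "\<psi> = (\<lambda>p\<in>points G. \<infinity>)" | w where "weight w" "\<psi> = (\<lambda>p\<in>points G. ereal (phi w p))"
      by (auto simp: adjoin_zero_def series_def)
    then show "\<psi> \<in> f ` flag_vectors U"
    proof cases
      case 1
      have "(\<lambda>i\<in>ground U. \<infinity>) \<in> flag_vectors U"
        by (auto simp: flag_vectors_def U.ground_flat)
      moreover have "f (\<lambda>i\<in>ground U. \<infinity>) = \<psi>"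
        unfolding 1 f_def ephi_top[symmetric] by (rule ephi_cong) (simp add: U(2))
      ultimately show ?thesis by blast
    next
      case 2
      define v where "v = (\<lambda>i\<in>ground U. ereal (w (inv_into H g i)))"
      have vg: "v (g F) = ereal (w F)" if "F \<in> H" for F
        using that \<open>inj_on g H\<close> by (simp add: v_def U(2))
      have "{F \<in> H. c \<le> v (g F)} \<in> flats W" for c
      proof -
        have "{F \<in> H. c \<le> v (g F)} = {F \<in> H. c \<le> ereal (w F)}" using vg by auto
        moreover have "\<dots> \<in> flats W"
        proof (cases c)
          case (real r)
          then show ?thesis using 2(1) by (simp add: weight_def)
        next
          case PInf
          then show ?thesis using empty_flat by simp
        next
          case MInf
          then show ?thesis using W.ground_flat ground_W by simp
        qed
        ultimately show ?thesis by simp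
      qed
      then have "v \<in> flag_vectors U"
        using level by (auto simp: flag_vectors_def v_def)
      moreover have "f v = \<psi>"
        unfolding 2(2) ephi_real[symmetric] f_def by (rule ephi_cong) (rule vg)
      ultimately show ?thesis by blast
    qed
  qed
  then show "\<exists>(N :: nat set) V f. valuated_matroid N V \<and> valuated_matroid_has_rank N V (2 + 1) \<and>
      tropical_hom N V (points G) f \<and> f ` V = adjoin_zero G series"
    using U.valuated_matroid_flag_vectors U.flag_vectors_rank hom U(3) by auto
qed (rule series_linear)

end

theorem theorem7p3:
  fixes M :: "'a matroid" and W :: "'a set matroid"
    and l :: "'a \<times> 'a set \<Rightarrow> real"
  assumes "is_matroid M" and "is_simple M" and "matroid_rank M = 3"
    and "\<forall>e\<in>edges (levi_graph M l). len (levi_graph M l) e = 1"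
    and "is_adjoint M W"
  shows "\<exists>S r. matroidal_linear_series (levi_graph M l) (cartwright_divisor M) r S
             \<and> is_local_matroid M l S W"
proof -
  interpret levi_adjoint M W l
    by unfold_locales (use assms in \<open>auto simp: levi_graph_def\<close>)
  show ?thesis using series_matroidal series_local_matroid by blast
qed

end
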